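(* There exists a number $x\in\Lambda$ (in the domain of $\Phi$) for which $\Phi(\cdot)$ is not computable at $x$.
   Context: **Computability at a point.** $\mathbb{D}=\{p2^q: p,q\in\mathbb{Z}\}$. An oracle for $x\in\mathbb{R}$ is a function $\phi:\mathbb{N}\to\mathbb{D}$ with $|\phi(n)-x|<2^{-n}$ for all $n\in\mathbb{N}$. An oracle Turing machine $M^\phi$ is a Turing machine which at any step of its computation may query $\phi(n)$ for any $n$. A real-valued function $f$ is computable at a point $x$ of its domain if there exists an oracle Turing machine $M^\phi$ such that for every oracle $\phi$ for $x$, on input $n\in\mathbb{N}$ the machine $M^\phi$ outputs a number $d_n\in\mathbb{D}$ with $|f(x)-d_n|\le2^{-n}$ (using $<$ instead of $\le$ is equivalent). **The map $G$.** Let $S=J_1\sqcup J_2\sqcup J_3\sqcup\cdots\subseteq(0,1)$ be a disjoint union of countably many open intervals $J_i=(\ell_i,r_i)$, $i\in\mathbb{Z}^+$, with $\ell_1>\ell_2>\cdots$, and let $s_0=\inf S$, $s_1=\sup S$. Let $G:S\to(0,1)$ be $\mathcal{C}^1$, let $G_i=G|_{J_i}$, let $G_i^{-1}:(s_0,s_1)\to J_i$ be the branch of $G^{-1}$ mapping into $J_i$, and let $G^k$ denote the $k$-th iterate (where defined). Assume: (G1) $G(J_i)=(s_0,s_1)$ for each $i$. (G2) $|G'|>1$, and there exist $\tau>1$, $\sigma>1$ and an integer $\kappa\ge1$ such that, with $\tau_{i,1}=\inf_{x\in J_i}|G'(x)|$ and $\tau_{i,\kappa}=\inf_{x\in J_i}|(G^\kappa)'(x)|$,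 one has $\tau_{i,1}^{-1}<\ell_i\sigma$ and $\tau_{i,\kappa}^{-1}<\ell_i\tau^{-1}$ for all $i$. (G3) $G_1$ is decreasing on $J_1$. (G4) Let $\varphi$ be the unique fixed point of $G_1$ and $\delta_G(N)=G_N^{-1}(\varphi)-G_{N+1}^{-1}(\varphi)>0$. There is $D>0$ such that for all $N\in\mathbb{Z}^+$, $\frac{r_{N+1}}{\ell_{N+1}}\cdot\frac{r_N-\ell_{N+1}}{\delta_G(N)}<D$. (G7) $g(i):=\frac{r_i}{\ell_{i+1}}-1\to0$ as $i\to\infty$. Let $\Lambda=\bigcap_{j\ge0}G^{-j}((s_0,s_1))$, i.e. the set of points all of whose iterates under $G$ are defined and lie in $S$. Each $x\in\Lambda$ is identified with its symbolic representation $x=[a_1,a_2,\ldots]$, $a_j\in\mathbb{Z}^+$, where $G^{j-1}(x)\in J_{a_j}$; this conjugates $G|_\Lambda$ to the full shift over $\mathbb{Z}^+$. For $j\ge1$ let $\eta_j=G^{j-1}:\Lambda\to\Lambda$, and let $\eta_0\equiv1$. **The weight $u$.** Let $u:(s_0,s_1)\to\mathbb{R}^+$ be $\mathcal{C}^1$ with $\lim_{x\to s_0^+}u(x)=\infty$, and such that there is some $C>0$ with $u'(x)<\frac{C}{(x-s_0)^2}$ for all $x\in(s_0,s_1)$. **The function $\Phi$.** Fix $\nu>0$ and signs $s(i)\in\{-1,1\}$, $i\ge1$. Define $\Phi(x)=\sum_{i=1}^{\infty}s(i)\left(\eta_0(x)\cdots\eta_{i-1}(x)\right)^\nu u(\eta_i(x))$,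 regarded as a real-valued function whose domain is the set of $x\in\Lambda$ for which the series converges to a finite value. *)

theory Defs
  imports "HOL-Analysis.Analysis"
begin

section \<open>Oracle Turing machines and computability at a point\<close>

text \<open>
  A two-tape machine: a work tape (also used for input and output) and an oracle tape.  A tape is
  two-way infinite; \<open>(ls, rs)\<close> has the head on the first cell of \<open>rs\<close>, the cells to its left are
  \<open>ls\<close> (nearest first), and all cells not listed are blank.  The alphabet is infinite as a type,
  but a program is a finite table and so mentions only finitely many states and symbols.
\<close>

datatype symbol = Blank | Bit bool | Sep | Aux nat

datatype direction = Left | Stay | Right

type_synonym tape = "symbol list \<times> symbol list"

fun tape_read :: "tape \<Rightarrow> symbol" where
  "tape_read (ls, []) = Blank"
| "tape_read (ls, a # rs) = a"

fun tape_write :: "symbol \<Rightarrow> tape \<Rightarrow> tape" where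
  "tape_write a (ls, rs) = (ls, a # tl rs)"

fun tape_move :: "direction \<Rightarrow> tape \<Rightarrow> tape" where
  "tape_move Stay t = t"
| "tape_move Left ([], rs) = ([], Blank # rs)"
| "tape_move Left (a # ls, rs) = (ls, a # rs)"
| "tape_move Right (ls, rs) = (tape_read (ls, rs) # ls, tl rs)"

definition tape_word :: "tape \<Rightarrow> symbol list" where
  "tape_word t = takeWhile (\<lambda>a. a \<noteq> Blank) (snd t)"

text \<open>
  \<open>Act q a d b e\<close>: write \<open>a\<close> and move by \<open>d\<close> on the work tape, write \<open>b\<close> and move by \<open>e\<close> on the
  oracle tape, go to state \<open>q\<close>.  \<open>Query q\<close>: consult the oracle and go to state \<open>q\<close>.
\<close>

datatype action =
    Act nat symbol direction symbol direction
  | Query nat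

text \<open>Finite transition table; the machine halts when no entry applies.\<close>

type_synonym machine = "((nat \<times> symbol \<times> symbol) \<times> action) list"

type_synonym config = "nat \<times> tape \<times> tape"

text \<open>Binary words are written least significant bit first; an integer has a leading sign bit.\<close>

fun nat_word :: "nat \<Rightarrow> symbol list" where
  "nat_word n = (if n = 0 then [] else Bit (odd n) # nat_word (n div 2))"

definition word_nat :: "symbol list \<Rightarrow> nat" where
  "word_nat w = horner_sum of_bool 2 (map (\<lambda>a. a = Bit True) w)"

definition int_word :: "int \<Rightarrow> symbol list" where
  "int_word z = Bit (z < 0) # nat_word (nat \<bar>z\<bar>)"

definition pair_word :: "int \<Rightarrow> int \<Rightarrow> symbol list" where
  "pair_word p q = int_word p @ Sep # int_word q"

text \<open>
  A query replaces the word \<open>w\<close> at the head of the oracle tape by the word \<open>\<omega> n\<close>, where \<open>n\<close> is the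
  number with binary representation \<open>w\<close>.
\<close>

definition step :: "machine \<Rightarrow> (nat \<Rightarrow> symbol list) \<Rightarrow> config \<Rightarrow> config option" where
  "step M \<omega> = (\<lambda>(q, t, t').
     case map_of M (q, tape_read t, tape_read t') of
       None \<Rightarrow> None
     | Some (Act q' a d b e) \<Rightarrow>
         Some (q', tape_move d (tape_write a t), tape_move e (tape_write b t'))
     | Some (Query q') \<Rightarrow> Some (q', t, ([], \<omega> (word_nat (tape_word t')))))"

definition initial_config :: "nat \<Rightarrow> config" where
  "initial_config n = (0, ([], nat_word n), ([], []))"

definition halts_with :: "machine \<Rightarrow> (nat \<Rightarrow> symbol list) \<Rightarrow> nat \<Rightarrow> symbol list \<Rightarrow> bool" where
  "halts_with M \<omega> n w \<longleftrightarrow>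
     (\<exists>q t t'. (\<lambda>c c'. step M \<omega> c = Some c')\<^sup>*\<^sup>* (initial_config n) (q, t, t')
        \<and> step M \<omega> (q, t, t') = None \<and> tape_word t = w)"

definition dyadics :: "real set" where
  "dyadics = {of_int p * 2 powi q | p q :: int. True}"

text \<open>
  The oracle returns a dyadic number in its unique reduced form \<open>p 2\<^sup>q\<close>, with \<open>p\<close> odd, or
  \<open>p = q = 0\<close>.  The machine may output any representation of a dyadic number.
\<close>

definition dyadic_word :: "real \<Rightarrow> symbol list" where
  "dyadic_word d =
     (THE w. \<exists>p q. d = of_int p * 2 powi q \<and> (odd p \<or> p = 0 \<and> q = 0) \<and> w = pair_word p q)"

definition outputs :: "machine \<Rightarrow> (nat \<Rightarrow> real) \<Rightarrow> nat \<Rightarrow> real \<Rightarrow> bool" where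
  "outputs M \<phi> n d \<longleftrightarrow>
     (\<exists>p q. halts_with M (dyadic_word \<circ> \<phi>) n (pair_word p q) \<and> d = of_int p * 2 powi q)"

definition is_oracle :: "(nat \<Rightarrow> real) \<Rightarrow> real \<Rightarrow> bool" where
  "is_oracle \<phi> x \<longleftrightarrow> (\<forall>n. \<phi> n \<in> dyadics \<and> \<bar>\<phi> n - x\<bar> < 1 / 2 ^ n)"

definition computable_at :: "(real \<Rightarrow> real) \<Rightarrow> real \<Rightarrow> bool" where
  "computable_at f x \<longleftrightarrow>
     (\<exists>M. \<forall>\<phi>. is_oracle \<phi> x \<longrightarrow> (\<forall>n. \<exists>d. outputs M \<phi> n d \<and> \<bar>f x - d\<bar> \<le> 1 / 2 ^ n))"


section \<open>The map \<open>G\<close>\<close>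

text \<open>
  The intervals are indexed by the positive integers; the values \<open>l 0\<close> and \<open>r 0\<close> are irrelevant,
  and so are the values of \<open>G\<close> outside \<open>S l r\<close>.
\<close>

definition J :: "(nat \<Rightarrow> real) \<Rightarrow> (nat \<Rightarrow> real) \<Rightarrow> nat \<Rightarrow> real set" where
  "J l r i = {l i <..< r i}"

definition S :: "(nat \<Rightarrow> real) \<Rightarrow> (nat \<Rightarrow> real) \<Rightarrow> real set" where
  "S l r = (\<Union>i\<in>{1..}. J l r i)"

definition s0 :: "(nat \<Rightarrow> real) \<Rightarrow> (nat \<Rightarrow> real) \<Rightarrow> real" where
  "s0 l r = Inf (S l r)"

definition s1 :: "(nat \<Rightarrow> real) \<Rightarrow> (nat \<Rightarrow> real) \<Rightarrow> real" where
  "s1 l r = Sup (S l r)"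

text \<open>The infimum of \<open>\<bar>(G\<^sup>k)'\<bar>\<close> over the points of \<open>J\<^sub>i\<close> at which the iterate \<open>G\<^sup>k\<close> is defined.\<close>

definition tau :: "(nat \<Rightarrow> real) \<Rightarrow> (nat \<Rightarrow> real) \<Rightarrow> (real \<Rightarrow> real) \<Rightarrow> nat \<Rightarrow> nat \<Rightarrow> real" where
  "tau l r G i k =
     (INF x\<in>{x \<in> J l r i. \<forall>j<k. (G ^^ j) x \<in> S l r}. \<bar>deriv (G ^^ k) x\<bar>)"

definition branch :: "(nat \<Rightarrow> real) \<Rightarrow> (nat \<Rightarrow> real) \<Rightarrow> (real \<Rightarrow> real) \<Rightarrow> nat \<Rightarrow> real \<Rightarrow> real" where
  "branch l r G i = inv_into (J l r i) G"

definition fixpt :: "(nat \<Rightarrow> real) \<Rightarrow> (nat \<Rightarrow> real) \<Rightarrow> (real \<Rightarrow> real) \<Rightarrow> real" where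
  "fixpt l r G = (THE x. x \<in> J l r 1 \<and> G x = x)"

definition delta :: "(nat \<Rightarrow> real) \<Rightarrow> (nat \<Rightarrow> real) \<Rightarrow> (real \<Rightarrow> real) \<Rightarrow> nat \<Rightarrow> real" where
  "delta l r G N = branch l r G N (fixpt l r G) - branch l r G (Suc N) (fixpt l r G)"

definition Lambda :: "(nat \<Rightarrow> real) \<Rightarrow> (nat \<Rightarrow> real) \<Rightarrow> (real \<Rightarrow> real) \<Rightarrow> real set" where
  "Lambda l r G = {x. \<forall>j. (G ^^ j) x \<in> S l r}"


section \<open>The function \<open>\<Phi>\<close>\<close>

definition eta :: "(real \<Rightarrow> real) \<Rightarrow> nat \<Rightarrow> real \<Rightarrow> real" where
  "eta G j x = (if j = 0 then 1 else (G ^^ (j - 1)) x)"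

definition Phi_term ::
  "(real \<Rightarrow> real) \<Rightarrow> (real \<Rightarrow> real) \<Rightarrow> real \<Rightarrow> (nat \<Rightarrow> real) \<Rightarrow> real \<Rightarrow> nat \<Rightarrow> real" where
  "Phi_term G u \<nu> s x i = s i * (\<Prod>j<i. eta G j x) powr \<nu> * u (eta G i x)"

text \<open>The series starts at \<open>i = 1\<close>.\<close>

definition Phi ::
  "(real \<Rightarrow> real) \<Rightarrow> (real \<Rightarrow> real) \<Rightarrow> real \<Rightarrow> (nat \<Rightarrow> real) \<Rightarrow> real \<Rightarrow> real" where
  "Phi G u \<nu> s x = (\<Sum>i. Phi_term G u \<nu> s x (Suc i))"

definition Phi_domain ::
  "(nat \<Rightarrow> real) \<Rightarrow> (nat \<Rightarrow> real) \<Rightarrow> (real \<Rightarrow> real) \<Rightarrow> (real \<Rightarrow> real) \<Rightarrow> real \<Rightarrow> (nat \<Rightarrow> real) \<Rightarrow> real set"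
  where
  "Phi_domain l r G u \<nu> s =
     {x \<in> Lambda l r G. summable (\<lambda>i. Phi_term G u \<nu> s x (Suc i))}"

end

theory Submission
  imports Defs
begin

text \<open>
  A machine that halts has consulted only finitely many values of its oracle for \<open>x\<close>, and these are
  also initial values of an oracle for any point near \<open>x\<close> (\<open>outputs_nearby\<close>).  So \<open>\<Phi>\<close> is
  continuous when restricted to the points at which a given machine computes it.  But \<open>\<Phi>\<close>
  is very discontinuous.  Let \<open>x = [w, 2, 2, 2, \<dots>]\<close>, and replace one of the late twos by a digit \<open>N\<close>.
  Since \<open>u\<close> is infinite at \<open>s\<^sub>0\<close> and the products of the \<open>\<eta>\<^sub>j\<close> decay along a block of twos, the term of the
  digit \<open>N\<close> becomes, by first choosing \<open>N\<close> huge and then the place of \<open>N\<close> far out, comparable to any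
  prescribed \<open>\<epsilon> > 0\<close>, while the sum of the changes of all other terms is much smaller than \<open>\<epsilon>\<close>
  (\<open>pivot_preimages_perturb\<close>).  The digit \<open>2\<close> is convenient because the closure of \<open>J\<^sub>2\<close> is a compact
  subset of \<open>(s\<^sub>0, s\<^sub>1)\<close>, so that on it \<open>u\<close> is bounded and the inverse branch into \<open>J\<^sub>2\<close> contracts.

  There are countably many machines, and they are defeated one after the other by a nested sequence of
  neighbourhoods.  In the neighbourhood at hand, two cases are possible (\<open>defeat_machine\<close>).  If
  the machine has an output of sufficient precision for some oracle for some point \<open>y = [v, 2, 2, \<dots>]\<close> of the
  neighbourhood, then it has the same output for all points near \<open>y\<close>; that output is wrong at \<open>y\<close> or at
  a perturbation of \<open>y\<close>, hence throughout a small neighbourhood of one of them.  If there is no such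
  \<open>y\<close>, then the machine has no output of that precision at a limit of such points either.

  A neighbourhood constrains the point and, by a common bound, all partial sums of the series
  (\<open>nbhd\<close>).  Because each partial sum is continuous on \<open>\<Lambda>\<close>, the partial sums at the common point of the
  nested neighbourhoods are a uniform limit of convergent sequences; so the series converges there, to a
  value within the bounds (\<open>exists_noncomputable_point\<close>).
\<close>

section \<open>Oracle machines\<close>

text \<open>There are only countably many machines.\<close>

instance symbol :: countable by countable_datatype
instance direction :: countable by countable_datatype
instance action :: countable by countable_datatype

text \<open>As a rewrite rule, the recursion equation of \<^const>\<open>nat_word\<close> would not terminate.\<close>

declare nat_word.simps [simp del]

lemma nat_word_0 [simp]: "nat_word 0 = []"
  by (subst nat_word.simps) simp

lemma nat_word_pos: "n > 0 \<Longrightarrow> nat_word n = Bit (odd n) # nat_word (n div 2)"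
  by (subst nat_word.simps) simp

lemma nat_word_inj: "nat_word m = nat_word n \<Longrightarrow> m = n"
proof (induction m arbitrary: n rule: less_induct)
  case (less m)
  show ?case
  proof (cases "m = 0 \<or> n = 0")
    case True
    with less.prems nat_word_pos show ?thesis
      by (metis gr0I list.distinct(1) nat_word_0)
  next
    case False
    with less.prems have "odd m = odd n" and half: "nat_word (m div 2) = nat_word (n div 2)"
      by (simp_all add: nat_word_pos)
    moreover from half have "m div 2 = n div 2"
      using less.IH[of "m div 2"] False by simp
    ultimately show ?thesis
      by presburger
  qed
qed

lemma Sep_notin_nat_word: "Sep \<notin> set (nat_word n)"
proof (induction n rule: less_induct)
  case (less n)
  then show ?case
    by (cases "n = 0") (simp_all add: nat_word_pos)
qed

lemma int_word_inj: "int_word p = int_word q \<Longrightarrow> p = q"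
  unfolding int_word_def by (auto dest!: nat_word_inj split: if_splits)

lemma pair_word_inj:
  assumes "pair_word p q = pair_word p' q'"
  shows "p = p' \<and> q = q'"
proof -
  have split: "takeWhile (\<lambda>a. a \<noteq> Sep) (pair_word a b) = int_word a \<and>
      dropWhile (\<lambda>a. a \<noteq> Sep) (pair_word a b) = Sep # int_word b" for a b
  proof -
    have "\<forall>c \<in> set (int_word a). c \<noteq> Sep"
      using Sep_notin_nat_word by (auto simp: int_word_def)
    then show ?thesis
      unfolding pair_word_def by (simp add: dropWhile_append2)
  qed
  from assms split[of p q] split[of p' q'] have "int_word p = int_word p'" "int_word q = int_word q'"
    by auto
  then show ?thesis by (auto dest: int_word_inj)
qed

lemma step_None_iff: "step M \<omega> c = None \<longleftrightarrow> step M \<omega>' c = None"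
  unfolding step_def by (auto split: prod.splits option.splits action.splits)

lemma terminal_unique:
  assumes "(\<lambda>c c'. f c = Some c')\<^sup>*\<^sup>* c a" "f a = None"
    and "(\<lambda>c c'. f c = Some c')\<^sup>*\<^sup>* c b" "f b = None"
  shows "a = b"
  using assms
proof (induction rule: converse_rtranclp_induct)
  case base
  from base.prems(2) show ?case
    by (cases rule: converse_rtranclpE) (use base.prems in simp_all)
next
  case (step y z)
  from step.prems(2) have "(\<lambda>c c'. f c = Some c')\<^sup>*\<^sup>* z b"
    by (cases rule: converse_rtranclpE) (use step.prems step.hyps(1) in simp_all)
  with step.IH step.prems show ?case
    by blast
qed

lemma halts_with_unique:
  assumes "halts_with M \<omega> n w" and "halts_with M \<omega> n w'"
  shows "w = w'"
proof -
  from assms(1) obtain q t t' where 1: "(\<lambda>c c'. step M \<omega> c = Some c')\<^sup>*\<^sup>* (initial_config n) (q, t, t')"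
      "step M \<omega> (q, t, t') = None" "tape_word t = w"
    unfolding halts_with_def by blast
  from assms(2) obtain p v v' where 2: "(\<lambda>c c'. step M \<omega> c = Some c')\<^sup>*\<^sup>* (initial_config n) (p, v, v')"
      "step M \<omega> (p, v, v') = None" "tape_word v = w'"
    unfolding halts_with_def by blast
  from terminal_unique[OF 1(1,2) 2(1,2)] 1(3) 2(3) show ?thesis
    by simp
qed

lemma outputs_unique:
  assumes "outputs M \<phi> n d" and "outputs M \<phi> n d'"
  shows "d = d'"
  using assms unfolding outputs_def by (metis halts_with_unique pair_word_inj)

lemma run_finite_use:
  assumes "(\<lambda>c c'. step M \<omega> c = Some c')\<^sup>*\<^sup>* c c'"
  shows "\<exists>k::nat. \<forall>\<omega>'. (\<forall>j<k. \<omega>' j = \<omega> j) \<longrightarrow> (\<lambda>c c'. step M \<omega>' c = Some c')\<^sup>*\<^sup>* c c'"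
  using assms
proof (induction rule: rtranclp_induct)
  case base
  then show ?case by auto
next
  case (step y z)
  then obtain k where k: "\<And>\<omega>'. \<forall>j<k. \<omega>' j = \<omega> j \<Longrightarrow> (\<lambda>c c'. step M \<omega>' c = Some c')\<^sup>*\<^sup>* c y"
    by blast
  obtain q t t' where y: "y = (q, t, t')" by (cases y)
  let ?k = "max k (Suc (word_nat (tape_word t')))"
  have "(\<lambda>c c'. step M \<omega>' c = Some c')\<^sup>*\<^sup>* c z" if "\<forall>j<?k. \<omega>' j = \<omega> j" for \<omega>'
  proof (rule rtranclp.rtrancl_into_rtrancl)
    show "(\<lambda>c c'. step M \<omega>' c = Some c')\<^sup>*\<^sup>* c y"
      using that by (intro k) auto
    have "\<omega>' (word_nat (tape_word t')) = \<omega> (word_nat (tape_word t'))"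
      using that by simp
    with step.hyps(2) show "step M \<omega>' y = Some z"
      unfolding y step_def by (auto split: option.splits action.splits)
  qed
  then show ?case by blast
qed

text \<open>A halting computation consults only finitely many values of its oracle.\<close>

lemma outputs_finite_use:
  assumes "outputs M \<phi> n d"
  shows "\<exists>k. \<forall>\<phi>'. (\<forall>j<k. \<phi>' j = \<phi> j) \<longrightarrow> outputs M \<phi>' n d"
proof -
  from assms obtain p q a t t' where d: "d = of_int p * 2 powi q"
    and run: "(\<lambda>c c'. step M (dyadic_word \<circ> \<phi>) c = Some c')\<^sup>*\<^sup>* (initial_config n) (a, t, t')"
    and halt: "step M (dyadic_word \<circ> \<phi>) (a, t, t') = None" and w: "tape_word t = pair_word p q"
    unfolding outputs_def halts_with_def by blast
  from run_finite_use[OF run] obtain k where k: "\<And>\<omega>'. \<forall>j<k. \<omega>' j = (dyadic_word \<circ> \<phi>) j \<Longrightarrow>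
      (\<lambda>c c'. step M \<omega>' c = Some c')\<^sup>*\<^sup>* (initial_config n) (a, t, t')"
    by blast
  have "outputs M \<phi>' n d" if "\<forall>j<k. \<phi>' j = \<phi> j" for \<phi>'
  proof -
    have "(\<lambda>c c'. step M (dyadic_word \<circ> \<phi>') c = Some c')\<^sup>*\<^sup>* (initial_config n) (a, t, t')"
      using that by (intro k) auto
    moreover have "step M (dyadic_word \<circ> \<phi>') (a, t, t') = None"
      using halt step_None_iff[of M _ "(a, t, t')"] by blast
    ultimately show ?thesis
      unfolding outputs_def halts_with_def using w d by blast
  qed
  then show ?thesis by blast
qed

lemma exists_oracle: "\<exists>\<phi>. is_oracle \<phi> x"
proof -
  define \<phi> where "\<phi> n = (of_int \<lfloor>x * 2 ^ n\<rfloor> * 2 powi (- int n) :: real)" for n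
  have "\<bar>\<phi> n - x\<bar> < 1 / 2 ^ n" for n
  proof -
    have "\<phi> n = of_int \<lfloor>x * 2 ^ n\<rfloor> / 2 ^ n"
      unfolding \<phi>_def by (simp add: power_int_minus divide_inverse)
    moreover have "x = x * 2 ^ n / 2 ^ n" by simp
    ultimately have "\<phi> n - x = (of_int \<lfloor>x * 2 ^ n\<rfloor> - x * 2 ^ n) / 2 ^ n"
      by (metis diff_divide_distrib)
    moreover have "\<bar>of_int \<lfloor>x * 2 ^ n\<rfloor> - x * 2 ^ n\<bar> < 1"
      by linarith
    ultimately show ?thesis
      by (simp add: divide_strict_right_mono)
  qed
  moreover have "\<phi> n \<in> dyadics" for n
    unfolding \<phi>_def dyadics_def by blast
  ultimately show ?thesis unfolding is_oracle_def by blast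
qed

text \<open>
  Because oracle values are subject to strict inequalities, the part of an oracle for \<open>x\<close> that a
  halting computation has seen is also part of an oracle for every point close to \<open>x\<close>.
\<close>

lemma outputs_nearby:
  assumes "is_oracle \<phi> x" and "outputs M \<phi> n d"
  shows "\<exists>\<delta>>0. \<forall>z. \<bar>z - x\<bar> < \<delta> \<longrightarrow> (\<exists>\<phi>'. is_oracle \<phi>' z \<and> outputs M \<phi>' n d)"
proof -
  from outputs_finite_use[OF assms(2)] obtain k
    where k: "\<And>\<phi>'. \<forall>j<k. \<phi>' j = \<phi> j \<Longrightarrow> outputs M \<phi>' n d" by blast
  define \<delta> where "\<delta> = Min (insert 1 ((\<lambda>j. 1 / 2 ^ j - \<bar>\<phi> j - x\<bar>) ` {..<k}))"
  have "\<delta> > 0"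
    unfolding \<delta>_def using assms(1) by (auto simp: is_oracle_def)
  moreover have "\<exists>\<phi>'. is_oracle \<phi>' z \<and> outputs M \<phi>' n d" if z: "\<bar>z - x\<bar> < \<delta>" for z
  proof -
    obtain \<psi> where \<psi>: "is_oracle \<psi> z" using exists_oracle by blast
    define \<phi>' where "\<phi>' j = (if j < k then \<phi> j else \<psi> j)" for j
    have "\<bar>\<phi>' j - z\<bar> < 1 / 2 ^ j" for j
    proof (cases "j < k")
      case True
      then have "\<delta> \<le> 1 / 2 ^ j - \<bar>\<phi> j - x\<bar>"
        unfolding \<delta>_def by (intro Min_le) auto
      then have "\<bar>\<phi> j - z\<bar> < 1 / 2 ^ j" using z by linarith
      then show ?thesis using True by (simp add: \<phi>'_def)
    next
      case False
      then show ?thesis using \<psi> by (simp add: \<phi>'_def is_oracle_def)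
    qed
    then have "is_oracle \<phi>' z"
      using assms(1) \<psi> by (auto simp: is_oracle_def \<phi>'_def)
    moreover have "outputs M \<phi>' n d"
      by (rule k) (simp add: \<phi>'_def)
    ultimately show ?thesis by blast
  qed
  ultimately show ?thesis by blast
qed

text \<open>\<open>computes M f x\<close>: the machine \<open>M\<close> computes \<open>f\<close> at the point \<open>x\<close>.\<close>

definition computes :: "machine \<Rightarrow> (real \<Rightarrow> real) \<Rightarrow> real \<Rightarrow> bool" where
  "computes M f x \<longleftrightarrow>
     (\<forall>\<phi>. is_oracle \<phi> x \<longrightarrow> (\<forall>n. \<exists>d. outputs M \<phi> n d \<and> \<bar>f x - d\<bar> \<le> 1 / 2 ^ n))"

lemma computable_at_iff: "computable_at f x \<longleftrightarrow> (\<exists>M. computes M f x)"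
  unfolding computable_at_def computes_def ..

lemma computes_outputs:
  assumes "computes M f x" "is_oracle \<phi> x" "outputs M \<phi> n d"
  shows "\<bar>f x - d\<bar> \<le> 1 / 2 ^ n"
  using assms outputs_unique unfolding computes_def by blast


section \<open>Diagonalisation against all machines\<close>

text \<open>
  A series of functions \<open>T i\<close>, continuous on the \<open>G\<^sub>\<delta>\<close> set \<open>\<Inter>k. U k\<close>, together with a set \<open>B\<close> of
  base points at which it converges.  The assumption \<open>perturb\<close> says that arbitrarily close to each
  base point there is another one whose partial sums are all within \<open>\<epsilon>\<close> of the original ones but
  whose value differs by at least \<open>c * \<epsilon>\<close>.
\<close>

locale perturbable_series =
  fixes T :: "nat \<Rightarrow> real \<Rightarrow> real" and U :: "nat \<Rightarrow> real set" and B :: "real set" and c :: real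
  assumes open_U: "open (U k)"
    and B_subset_U: "B \<subseteq> U k"
    and isCont_T: "(\<And>k. x \<in> U k) \<Longrightarrow> isCont (T i) x"
    and summable_B: "x \<in> B \<Longrightarrow> summable (\<lambda>i. T i x)"
    and B_nonempty: "B \<noteq> {}"
    and c_pos: "c > 0"
    and perturb: "\<lbrakk>x \<in> B; \<epsilon> > 0; \<delta> > 0\<rbrakk> \<Longrightarrow> \<exists>y\<in>B. \<bar>y - x\<bar> < \<delta> \<and>
           (\<forall>m. \<bar>(\<Sum>i<m. T i y) - (\<Sum>i<m. T i x)\<bar> \<le> \<epsilon>) \<and> c * \<epsilon> \<le> \<bar>(\<Sum>i. T i y) - (\<Sum>i. T i x)\<bar>"
begin

definition psum :: "nat \<Rightarrow> real \<Rightarrow> real" where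
  "psum m x = (\<Sum>i<m. T i x)"

definition series_sum :: "real \<Rightarrow> real" where
  "series_sum x = (\<Sum>i. T i x)"

text \<open>
  Closeness is measured in the argument and uniformly in all partial sums, so that a limit of base
  points along shrinking neighbourhoods is again a point of convergence, and the values of the series converge too.
\<close>

definition nbhd :: "real \<Rightarrow> real \<Rightarrow> real \<Rightarrow> real set" where
  "nbhd x \<delta> e = {y. \<bar>y - x\<bar> \<le> \<delta> \<and> (\<forall>m. \<bar>psum m y - psum m x\<bar> \<le> e)}"

text \<open>Points of convergence in \<open>nbhd x \<delta> e\<close> that base points in \<open>nbhd x \<delta> e\<close> approach.\<close>

definition nbhd_limit :: "real \<Rightarrow> real \<Rightarrow> real \<Rightarrow> real \<Rightarrow> bool" where
  "nbhd_limit x \<delta> e z \<longleftrightarrow> z \<in> nbhd x \<delta> e \<and> summable (\<lambda>i. T i z) \<and>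
     (\<forall>\<eta>>0. \<exists>y\<in>B \<inter> nbhd x \<delta> e. \<bar>y - z\<bar> < \<eta>)"

lemma psum_LIMSEQ: "summable (\<lambda>i. T i x) \<Longrightarrow> (\<lambda>m. psum m x) \<longlonglongrightarrow> series_sum x"
  unfolding psum_def series_sum_def by (rule summable_LIMSEQ)

lemma series_sum_dist_le:
  assumes "summable (\<lambda>i. T i x)" "summable (\<lambda>i. T i y)" "\<And>m. \<bar>psum m y - psum m x\<bar> \<le> e"
  shows "\<bar>series_sum y - series_sum x\<bar> \<le> e"
proof (rule LIMSEQ_le_const2)
  show "(\<lambda>m. \<bar>psum m y - psum m x\<bar>) \<longlonglongrightarrow> \<bar>series_sum y - series_sum x\<bar>"
    by (intro tendsto_intros psum_LIMSEQ assms)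
  show "\<exists>N. \<forall>m\<ge>N. \<bar>psum m y - psum m x\<bar> \<le> e"
    using assms(3) by blast
qed

lemma nbhd_mono:
  assumes "\<bar>y - x\<bar> + \<delta>' \<le> \<delta>" "\<And>m. \<bar>psum m y - psum m x\<bar> + e' \<le> e"
  shows "nbhd y \<delta>' e' \<subseteq> nbhd x \<delta> e"
proof
  fix z assume "z \<in> nbhd y \<delta>' e'"
  then have z: "\<bar>z - y\<bar> \<le> \<delta>'" "\<And>m. \<bar>psum m z - psum m y\<bar> \<le> e'"
    by (auto simp: nbhd_def)
  have "\<bar>psum m z - psum m x\<bar> \<le> e" for m
    using z(2)[of m] assms(2)[of m] by linarith
  moreover have "\<bar>z - x\<bar> \<le> \<delta>"
    using z(1) assms(1) by linarith
  ultimately show "z \<in> nbhd x \<delta> e"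
    by (simp add: nbhd_def)
qed

lemma small_ball_in_U:
  assumes "x \<in> B" "\<delta> > 0"
  obtains \<delta>' where "0 < \<delta>'" "\<delta>' \<le> \<delta>" "cball x \<delta>' \<subseteq> U k"
proof -
  from assms(1) B_subset_U open_U obtain \<rho> where "\<rho> > 0" "cball x \<rho> \<subseteq> U k"
    by (meson open_contains_cball subsetD)
  then show ?thesis
    using that[of "min \<rho> \<delta>"] assms(2) by (auto simp: subset_iff)
qed

text \<open>
  One step of the diagonal argument.  If some base point deep inside the neighbourhood makes \<open>M\<close> produce an
  output of high precision, that output is also produced for all points close by, whereas the
  perturbation changes the value of the series by more than the precision; so one of the two neighbourhoods
  around the base point and around its perturbation defeats \<open>M\<close>.  Otherwise \<open>M\<close> has no output
  of that precision at limits of base points deep inside the neighbourhood.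
\<close>

lemma defeat_machine:
  assumes x: "x \<in> B" and pos: "\<delta> > 0" "e > 0"
  shows "\<exists>x' \<delta>' e'. x' \<in> B \<and> 0 < \<delta>' \<and> \<delta>' \<le> \<delta> / 2 \<and> 0 < e' \<and> e' \<le> e / 2 \<and> cball x' \<delta>' \<subseteq> U k \<and>
           nbhd x' \<delta>' e' \<subseteq> nbhd x \<delta> e \<and> (\<forall>z. nbhd_limit x' \<delta>' e' z \<longrightarrow> \<not> computes M series_sum z)"
proof -
  \<comment> \<open>The perturbation by \<open>e / 4\<close> below moves the value by at least \<open>16 * t\<close>.\<close>
  define t where "t = c * e / 64"
  have "t > 0" using c_pos pos by (simp add: t_def)
  then obtain n where "(1 / 2) ^ n < t"
    using real_arch_pow_inv[of t "1 / 2"] by auto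
  then have n: "1 / 2 ^ n < t"
    by (simp add: power_one_over)
  show ?thesis
  proof (cases "\<exists>y\<in>B \<inter> nbhd x (\<delta> / 4) (e / 4). \<exists>\<phi> d. is_oracle \<phi> y \<and> outputs M \<phi> n d")
    case True
    then obtain y \<phi> d where y: "y \<in> B" "y \<in> nbhd x (\<delta> / 4) (e / 4)"
      and out: "is_oracle \<phi> y" "outputs M \<phi> n d" by blast
    from outputs_nearby[OF out] obtain \<delta>1 where \<delta>1: "\<delta>1 > 0"
      and near: "\<And>z. \<bar>z - y\<bar> < \<delta>1 \<Longrightarrow> \<exists>\<phi>'. is_oracle \<phi>' z \<and> outputs M \<phi>' n d" by blast
    from perturb[OF y(1), of "e / 4" "min \<delta>1 (\<delta> / 4)"] \<delta>1 pos obtain y'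
      where y': "y' \<in> B" "\<bar>y' - y\<bar> < \<delta>1" "\<bar>y' - y\<bar> < \<delta> / 4"
        "\<And>m. \<bar>psum m y' - psum m y\<bar> \<le> e / 4" "c * (e / 4) \<le> \<bar>series_sum y' - series_sum y\<bar>"
      by (auto simp: psum_def series_sum_def)
    \<comment> \<open>The values at \<open>y\<close> and \<open>y'\<close> are too far apart for \<open>d\<close> to approximate both.\<close>
    have "\<exists>z\<in>{y, y'}. 8 * t \<le> \<bar>series_sum z - d\<bar>"
    proof -
      have "16 * t \<le> \<bar>series_sum y' - series_sum y\<bar>" using y'(5) by (simp add: t_def)
      then have "8 * t \<le> \<bar>series_sum y' - d\<bar> \<or> 8 * t \<le> \<bar>series_sum y - d\<bar>" by linarith
      then show ?thesis by auto
    qed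
    then obtain z where z: "z \<in> {y, y'}" "8 * t \<le> \<bar>series_sum z - d\<bar>" by blast
    have zB: "z \<in> B" using z y y' by auto
    have zy: "\<bar>z - y\<bar> < \<delta>1" "\<bar>z - y\<bar> < \<delta> / 4" "\<And>m. \<bar>psum m z - psum m y\<bar> \<le> e / 4"
      using z(1) y' \<delta>1 pos by auto
    \<comment> \<open>Every point of the new neighbourhood has an oracle for which \<open>M\<close> outputs \<open>d\<close>.\<close>
    obtain \<delta>' where \<delta>': "0 < \<delta>'" "\<delta>' \<le> min (\<delta> / 2) ((\<delta>1 - \<bar>z - y\<bar>) / 2)" "cball z \<delta>' \<subseteq> U k"
      using small_ball_in_U[OF zB, of "min (\<delta> / 2) ((\<delta>1 - \<bar>z - y\<bar>) / 2)"] zy pos by auto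
    define e' where "e' = min (e / 2) t"
    have e': "0 < e'" "e' \<le> e / 2" "e' \<le> t" using pos \<open>t > 0\<close> by (auto simp: e'_def)
    have yx: "\<bar>y - x\<bar> \<le> \<delta> / 4" "\<And>m. \<bar>psum m y - psum m x\<bar> \<le> e / 4"
      using y(2) by (auto simp: nbhd_def)
    have sub: "nbhd z \<delta>' e' \<subseteq> nbhd x \<delta> e"
    proof (rule nbhd_mono)
      show "\<bar>z - x\<bar> + \<delta>' \<le> \<delta>"
        using yx(1) zy(2) \<delta>'(2) by linarith
      show "\<bar>psum m z - psum m x\<bar> + e' \<le> e" for m
        using yx(2)[of m] zy(3)[of m] e'(2) by linarith
    qed
    have "\<not> computes M series_sum w" if "nbhd_limit z \<delta>' e' w" for w
    proof
      assume comp: "computes M series_sum w"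
      from that have w: "\<bar>w - z\<bar> \<le> \<delta>'" "\<And>m. \<bar>psum m w - psum m z\<bar> \<le> e'" "summable (\<lambda>i. T i w)"
        by (auto simp: nbhd_limit_def nbhd_def)
      have "\<delta>' \<le> (\<delta>1 - \<bar>z - y\<bar>) / 2" using \<delta>'(2) by simp
      then have "\<bar>w - y\<bar> < \<delta>1" using w(1) zy(1) by argo
      then obtain \<phi>' where "is_oracle \<phi>' w" "outputs M \<phi>' n d" using near by blast
      then have "\<bar>series_sum w - d\<bar> \<le> 1 / 2 ^ n" using comp computes_outputs by blast
      moreover have "\<bar>series_sum w - series_sum z\<bar> \<le> e'"
        by (rule series_sum_dist_le[OF summable_B[OF zB] w(3) w(2)])
      ultimately show False using z(2) n e'(3) \<open>t > 0\<close> by linarith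
    qed
    then show ?thesis using zB \<delta>' e' sub by (intro exI[of _ z] exI[of _ \<delta>'] exI[of _ e']) auto
  next
    case False
    obtain \<delta>' where \<delta>': "0 < \<delta>'" "\<delta>' \<le> \<delta> / 4" "cball x \<delta>' \<subseteq> U k"
      using small_ball_in_U[OF x, of "\<delta> / 4"] pos by auto
    have sub: "nbhd x \<delta>' (e / 4) \<subseteq> nbhd x (\<delta> / 4) (e / 4)" "nbhd x \<delta>' (e / 4) \<subseteq> nbhd x \<delta> e"
      by (rule nbhd_mono; use \<delta>' pos in simp)+
    have "\<not> computes M series_sum w" if "nbhd_limit x \<delta>' (e / 4) w" for w
    proof
      assume comp: "computes M series_sum w"
      obtain \<phi> where \<phi>: "is_oracle \<phi> w" using exists_oracle by blast
      with comp obtain d where "outputs M \<phi> n d" unfolding computes_def by blast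
      from outputs_nearby[OF \<phi> this] obtain \<eta> where "\<eta> > 0"
        and near: "\<And>z. \<bar>z - w\<bar> < \<eta> \<Longrightarrow> \<exists>\<phi>'. is_oracle \<phi>' z \<and> outputs M \<phi>' n d" by blast
      with that obtain y where "y \<in> B \<inter> nbhd x \<delta>' (e / 4)" "\<bar>y - w\<bar> < \<eta>"
        unfolding nbhd_limit_def by blast
      with near sub(1) False show False by blast
    qed
    then show ?thesis using x pos \<delta>' sub
      by (intro exI[of _ x] exI[of _ \<delta>'] exI[of _ "e / 4"]) auto
  qed
qed

text \<open>
  The intersection of a nested sequence of neighbourhoods, the \<open>k\<close>-th of which lies in \<open>U k\<close> and
  defeats the \<open>k\<close>-th machine.
\<close>

theorem exists_noncomputable_point:
  "\<exists>x. (\<forall>k. x \<in> U k) \<and> summable (\<lambda>i. T i x) \<and> \<not> computable_at (\<lambda>x. \<Sum>i. T i x) x"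
proof -
  define P where "P = (\<lambda>N. case N of (x, \<delta>, e) \<Rightarrow> x \<in> B \<and> \<delta> > (0::real) \<and> e > (0::real))"
  define Q where "Q = (\<lambda>k N N'. case N of (x, \<delta>, e) \<Rightarrow> case N' of (x', \<delta>', e') \<Rightarrow>
    \<delta>' \<le> \<delta> / 2 \<and> e' \<le> e / 2 \<and> cball x' \<delta>' \<subseteq> U k \<and> nbhd x' \<delta>' e' \<subseteq> nbhd x \<delta> e \<and>
    (\<forall>z. nbhd_limit x' \<delta>' e' z \<longrightarrow> \<not> computes (from_nat k) series_sum z))"
  have "\<exists>N. \<forall>k. P (N k) \<and> Q k (N k) (N (Suc k))"
  proof (rule dependent_nat_choice)
    show "\<exists>N. P N"
    proof -
      from B_nonempty obtain x where "x \<in> B" by blast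
      then have "P (x, 1, 1)" by (simp add: P_def)
      then show ?thesis ..
    qed
    show "\<exists>N'. P N' \<and> Q k N N'" if "P N" for N k
    proof -
      obtain x \<delta> e where N: "N = (x, \<delta>, e)" by (cases N)
      with that have "x \<in> B" "\<delta> > 0" "e > 0" by (auto simp: P_def)
      from defeat_machine[OF this, of k "from_nat k"] show ?thesis
        unfolding N P_def Q_def by auto
    qed
  qed
  then obtain N where N: "\<And>k. P (N k)" "\<And>k. Q k (N k) (N (Suc k))" by blast
  define X where "X k = fst (N k)" for k
  define \<delta> where "\<delta> k = fst (snd (N k))" for k
  define e where "e k = snd (snd (N k))" for k
  have Neq: "N k = (X k, \<delta> k, e k)" for k by (simp add: X_def \<delta>_def e_def)
  have P: "X k \<in> B" "\<delta> k > 0" "e k > 0" for k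
    using N(1)[of k] unfolding P_def Neq by auto
  have Q: "\<delta> (Suc k) \<le> \<delta> k / 2" "e (Suc k) \<le> e k / 2" "cball (X (Suc k)) (\<delta> (Suc k)) \<subseteq> U k"
    "nbhd (X (Suc k)) (\<delta> (Suc k)) (e (Suc k)) \<subseteq> nbhd (X k) (\<delta> k) (e k)"
    "\<And>z. nbhd_limit (X (Suc k)) (\<delta> (Suc k)) (e (Suc k)) z \<Longrightarrow> \<not> computes (from_nat k) series_sum z" for k
    using N(2)[of k] unfolding Q_def Neq by auto
  have tends0: "g \<longlonglongrightarrow> 0" if "\<And>k. g k > 0" "\<And>k. g (Suc k) \<le> g k / 2" for g :: "nat \<Rightarrow> real"
  proof (rule tendsto_sandwich)
    have "g k \<le> g 0 * (1 / 2) ^ k" for k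
    proof (induction k)
      case (Suc k)
      then show ?case using that(2)[of k] by simp
    qed simp
    then show "\<forall>\<^sub>F k in sequentially. g k \<le> g 0 * (1 / 2) ^ k" by simp
    show "\<forall>\<^sub>F k in sequentially. 0 \<le> g k" using that(1) by (simp add: less_imp_le)
    show "(\<lambda>k. g 0 * (1 / 2) ^ k) \<longlonglongrightarrow> 0"
      by (intro tendsto_mult_right_zero LIMSEQ_power_zero) simp
  qed simp
  have \<delta>0: "\<delta> \<longlonglongrightarrow> 0" and e0: "e \<longlonglongrightarrow> 0"
    using tends0 P Q by blast+
  have in_nbhd: "X j \<in> nbhd (X k) (\<delta> k) (e k)" if "k \<le> j" for j k
  proof -
    have "nbhd (X j) (\<delta> j) (e j) \<subseteq> nbhd (X k) (\<delta> k) (e k)"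
      using that by (induction rule: dec_induct) (use Q(4) in blast)+
    moreover have "X j \<in> nbhd (X j) (\<delta> j) (e j)"
      using P[of j] by (simp add: nbhd_def)
    ultimately show ?thesis by blast
  qed
  have "Cauchy X"
  proof (rule metric_CauchyI)
    fix \<epsilon> :: real assume "\<epsilon> > 0"
    with \<delta>0 obtain k where k: "\<delta> k < \<epsilon> / 2"
      by (metis LIMSEQ_D P(2) abs_of_pos diff_zero half_gt_zero order_refl real_norm_def)
    have "dist (X m) (X n) < \<epsilon>" if "m \<ge> k" "n \<ge> k" for m n
    proof -
      have "\<bar>X m - X k\<bar> \<le> \<delta> k" "\<bar>X n - X k\<bar> \<le> \<delta> k"
        using in_nbhd that by (auto simp: nbhd_def)
      then show ?thesis using k unfolding dist_real_def by linarith
    qed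
    then show "\<exists>M. \<forall>m\<ge>M. \<forall>n\<ge>M. dist (X m) (X n) < \<epsilon>" by blast
  qed
  then obtain x where X: "X \<longlonglongrightarrow> x"
    using real_Cauchy_convergent convergent_def by blast
  have near: "\<bar>x - X k\<bar> \<le> \<delta> k" for k
  proof (rule LIMSEQ_le_const2)
    show "(\<lambda>j. \<bar>X j - X k\<bar>) \<longlonglongrightarrow> \<bar>x - X k\<bar>" by (intro tendsto_intros X)
    show "\<exists>M. \<forall>j\<ge>M. \<bar>X j - X k\<bar> \<le> \<delta> k" using in_nbhd by (auto simp: nbhd_def)
  qed
  have xU: "x \<in> U k" for k
    using Q(3)[of k] near[of "Suc k"] by (auto simp: dist_real_def abs_minus_commute)
  have psum_lim: "(\<lambda>j. psum m (X j)) \<longlonglongrightarrow> psum m x" for m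
    unfolding psum_def by (intro tendsto_sum isCont_tendsto_compose[OF isCont_T[OF xU] X])
  have psum_near: "\<bar>psum m x - psum m (X k)\<bar> \<le> e k" for m k
  proof (rule LIMSEQ_le_const2)
    show "(\<lambda>j. \<bar>psum m (X j) - psum m (X k)\<bar>) \<longlonglongrightarrow> \<bar>psum m x - psum m (X k)\<bar>"
      by (intro tendsto_intros psum_lim)
    show "\<exists>M. \<forall>j\<ge>M. \<bar>psum m (X j) - psum m (X k)\<bar> \<le> e k" using in_nbhd by (auto simp: nbhd_def)
  qed
  have summable_x: "summable (\<lambda>i. T i x)"
  proof -
    have "Cauchy (\<lambda>m. psum m x)"
    proof (rule metric_CauchyI)
      fix \<epsilon> :: real assume "\<epsilon> > 0"
      with e0 obtain k where k: "e k < \<epsilon> / 3"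
        by (metis LIMSEQ_D P(3) abs_of_pos diff_zero divide_pos_pos order_refl real_norm_def
            zero_less_numeral)
      have "Cauchy (\<lambda>m. psum m (X k))"
        using psum_LIMSEQ[OF summable_B[OF P(1)]] by (rule LIMSEQ_imp_Cauchy)
      then obtain M where M: "\<And>m n. m \<ge> M \<Longrightarrow> n \<ge> M \<Longrightarrow> dist (psum m (X k)) (psum n (X k)) < \<epsilon> / 3"
        using metric_CauchyD[of _ "\<epsilon> / 3"] \<open>\<epsilon> > 0\<close> by (metis divide_pos_pos zero_less_numeral)
      have "dist (psum m x) (psum n x) < \<epsilon>" if "m \<ge> M" "n \<ge> M" for m n
        using M[OF that] psum_near[of m k] psum_near[of n k] k unfolding dist_real_def by linarith
      then show "\<exists>M. \<forall>m\<ge>M. \<forall>n\<ge>M. dist (psum m x) (psum n x) < \<epsilon>" by blast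
    qed
    then show ?thesis
      unfolding psum_def summable_iff_convergent by (rule real_Cauchy_convergent)
  qed
  have limit: "nbhd_limit (X k) (\<delta> k) (e k) x" for k
    unfolding nbhd_limit_def
  proof (intro conjI allI impI)
    show "x \<in> nbhd (X k) (\<delta> k) (e k)"
      using near psum_near by (simp add: nbhd_def)
    show "\<exists>y\<in>B \<inter> nbhd (X k) (\<delta> k) (e k). \<bar>y - x\<bar> < \<eta>" if "\<eta> > 0" for \<eta>
    proof -
      from LIMSEQ_D[OF X that] obtain j where "\<And>i. i \<ge> j \<Longrightarrow> \<bar>X i - x\<bar> < \<eta>" by auto
      then show ?thesis using in_nbhd[of k "max j k"] P(1) by (intro bexI[of _ "X (max j k)"]) auto
    qed
  qed (rule summable_x)
  have "\<not> computes M series_sum x" for M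
    using Q(5)[of "to_nat M" x] limit by simp
  then have "\<not> computable_at series_sum x" by (simp add: computable_at_iff)
  then show ?thesis
    using xU summable_x unfolding series_sum_def by blast
qed

end


section \<open>Expanding maps with full branches\<close>

text \<open>
  A map each of whose infinitely many branches \<open>J i \<rightarrow> (s0, s1)\<close> is onto and expanding.
\<close>

locale full_branch_map =
  fixes l r :: "nat \<Rightarrow> real" and G :: "real \<Rightarrow> real"
  assumes interval: "1 \<le> i \<Longrightarrow> l i < r i"
    and disjoint: "disjoint_family_on (J l r) {1..}"
    and l_decreasing: "1 \<le> i \<Longrightarrow> l (Suc i) < l i"
    and S_subset: "S l r \<subseteq> {0<..<1}"
    and G_C1: "G C1_differentiable_on S l r"
    and G_image: "1 \<le> i \<Longrightarrow> G ` J l r i = {s0 l r <..< s1 l r}"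
    and expanding: "x \<in> S l r \<Longrightarrow> \<bar>deriv G x\<bar> > 1"
begin

text \<open>The common image of the branches.\<close>

abbreviation ambient :: "real set" where
  "ambient \<equiv> {s0 l r <..< s1 l r}"

lemma J_subset_S: "1 \<le> i \<Longrightarrow> J l r i \<subseteq> S l r"
  unfolding S_def by auto

lemma open_S: "open (S l r)"
  unfolding S_def J_def by auto

lemma J_nonempty: "1 \<le> i \<Longrightarrow> \<exists>x. x \<in> J l r i"
  using interval[of i] dense unfolding J_def by (metis greaterThanLessThan_iff)

lemma S_bdd: "bdd_below (S l r)" "bdd_above (S l r)"
  using S_subset by (meson bdd_below_Ioo bdd_above_Ioo bdd_below_mono bdd_above_mono)+

lemma S_subset_ambient: "S l r \<subseteq> ambient"
proof
  fix x assume "x \<in> S l r"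
  then obtain i where i: "1 \<le> i" "l i < x" "x < r i"
    by (auto simp: S_def J_def)
  obtain a b where "l i < a" "a < x" "x < b" "b < r i"
    using i dense by meson
  with i have "a \<in> S l r" "b \<in> S l r"
    by (auto simp: S_def J_def intro!: bexI[of _ i])
  with S_bdd \<open>a < x\<close> \<open>x < b\<close> show "x \<in> ambient"
    unfolding s0_def s1_def by (auto intro: le_less_trans[OF cInf_lower] less_le_trans[OF _ cSup_upper])
qed

lemma J_subset_ambient: "1 \<le> i \<Longrightarrow> J l r i \<subseteq> ambient"
  using J_subset_S S_subset_ambient by blast

lemma S_nonempty: "S l r \<noteq> {}"
  using J_nonempty[of 1] J_subset_S[of 1] by auto

lemma ambient_subset: "ambient \<subseteq> {0<..<1}"
proof -
  have "0 \<le> s0 l r" "s1 l r \<le> 1"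
    unfolding s0_def s1_def using S_subset
    by (auto intro!: cInf_greatest cSup_least S_nonempty)
  then show ?thesis by auto
qed

lemma r_le_l: assumes "1 \<le> i" shows "r (Suc i) \<le> l i"
proof (rule ccontr)
  assume "\<not> r (Suc i) \<le> l i"
  then have "l i < min (r i) (r (Suc i))"
    using interval[OF assms] by simp
  then obtain x where "l i < x" "x < min (r i) (r (Suc i))"
    using dense by blast
  then have "x \<in> J l r i \<inter> J l r (Suc i)"
    using l_decreasing[OF assms] by (auto simp: J_def)
  moreover have "J l r i \<inter> J l r (Suc i) = {}"
    by (rule disjoint_family_onD[OF disjoint]) (use assms in auto)
  ultimately show False
    by blast
qed

lemma s0_less_l: assumes "1 \<le> i" shows "s0 l r < l i"
proof -
  obtain x where "x \<in> J l r (Suc i)" using J_nonempty by force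
  moreover have "s0 l r < x" using calculation J_subset_ambient[of "Suc i"] by auto
  ultimately show ?thesis using r_le_l[OF assms] by (auto simp: J_def)
qed

text \<open>
  The second interval has an advantage over the first: it is bounded away from both ends of
  \<^term>\<open>ambient\<close>.
\<close>

lemma cl_J2: "0 < l 2" "l 2 < r 2" "r 2 < 1" "{l 2..r 2} \<subseteq> ambient"
proof -
  obtain x where x: "x \<in> J l r 1" using J_nonempty by force
  have "r 2 < x" using r_le_l[of 1] x by (simp add: J_def numeral_2_eq_2)
  moreover have "x \<in> ambient" using x J_subset_ambient[of 1] by auto
  ultimately have "r 2 < s1 l r" by auto
  moreover have "s0 l r < l 2" by (rule s0_less_l) simp
  ultimately show sub: "{l 2..r 2} \<subseteq> ambient" by auto
  show "l 2 < r 2" by (rule interval) simp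
  then have "l 2 \<in> {l 2..r 2}" "r 2 \<in> {l 2..r 2}" by auto
  with sub ambient_subset have "l 2 \<in> {0<..<1}" "r 2 \<in> {0<..<1}" by blast+
  then show "0 < l 2" "r 2 < 1" by auto
qed

lemma J2_subset: "J l r 2 \<subseteq> {l 2..r 2}"
  by (auto simp: J_def)

text \<open>The intervals accumulate at \<open>s0\<close>, which need not be \<open>0\<close>.\<close>

lemma J_near_s0: assumes "s0 l r < b" shows "\<exists>N\<ge>1. J l r N \<subseteq> {s0 l r <..< b}"
proof -
  obtain x where "x \<in> S l r" "x < b"
    using cInf_lessD[OF S_nonempty assms[unfolded s0_def]] by blast
  then obtain i where i: "1 \<le> i" "l i < b" by (auto simp: S_def J_def)
  have "J l r (Suc i) \<subseteq> {s0 l r <..< b}"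
    using J_subset_ambient[of "Suc i"] r_le_l[OF i(1)] i by (auto simp: J_def)
  then show ?thesis by (intro exI[of _ "Suc i"]) auto
qed

lemma DERIV_G: "x \<in> S l r \<Longrightarrow> DERIV G x :> deriv G x"
  and continuous_on_deriv_G: "continuous_on (S l r) (deriv G)"
proof -
  obtain D where D: "\<And>x. x \<in> S l r \<Longrightarrow> (G has_vector_derivative D x) (at x)" "continuous_on (S l r) D"
    using G_C1 unfolding C1_differentiable_on_def by blast
  then have D': "DERIV G x :> D x" if "x \<in> S l r" for x
    using that by (simp add: has_real_derivative_iff_has_vector_derivative)
  then have eq: "deriv G x = D x" if "x \<in> S l r" for x
    using that DERIV_imp_deriv by blast
  show "DERIV G x :> deriv G x" if "x \<in> S l r" using D' eq that by simp
  show "continuous_on (S l r) (deriv G)"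
    using D(2) eq by (simp cong: continuous_on_cong)
qed

lemma isCont_G: "x \<in> S l r \<Longrightarrow> isCont G x"
  using DERIV_G DERIV_isCont by blast

lemma expansion:
  assumes "{min a b..max a b} \<subseteq> S l r" "\<And>x. x \<in> {min a b..max a b} \<Longrightarrow> m \<le> \<bar>deriv G x\<bar>"
  shows "m * \<bar>a - b\<bar> \<le> \<bar>G a - G b\<bar>"
proof -
  have *: "m * \<bar>a - b\<bar> \<le> \<bar>G a - G b\<bar>"
    if ab: "a < b" "{a..b} \<subseteq> S l r" "\<And>x. x \<in> {a..b} \<Longrightarrow> m \<le> \<bar>deriv G x\<bar>" for a b
  proof -
    have "DERIV G x :> deriv G x" if "a \<le> x" "x \<le> b" for x
      using that ab(2) by (intro DERIV_G) auto
    from MVT2[OF ab(1) this] obtain z where z: "a < z" "z < b" "G b - G a = (b - a) * deriv G z"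
      by blast
    then have "\<bar>G a - G b\<bar> = \<bar>a - b\<bar> * \<bar>deriv G z\<bar>"
      by (metis abs_minus_commute abs_mult)
    moreover have "m \<le> \<bar>deriv G z\<bar>" using ab(3) z by simp
    ultimately show ?thesis by (simp add: mult.commute[of "\<bar>a - b\<bar>"] mult_right_mono)
  qed
  show ?thesis
  proof (cases a b rule: linorder_cases)
    case less
    then show ?thesis using *[of a b] assms by simp
  next
    case greater
    then show ?thesis using *[of b a] assms by (simp add: abs_minus_commute)
  qed simp
qed

lemma J_expansion:
  assumes "1 \<le> i" "a \<in> J l r i" "b \<in> J l r i"
  shows "\<bar>a - b\<bar> \<le> \<bar>G a - G b\<bar>"
proof -
  have "{min a b..max a b} \<subseteq> J l r i" using assms by (auto simp: J_def)
  then have "{min a b..max a b} \<subseteq> S l r" using J_subset_S[OF assms(1)] by blast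
  then have "1 * \<bar>a - b\<bar> \<le> \<bar>G a - G b\<bar>"
    by (intro expansion) (auto intro!: less_imp_le[OF expanding])
  then show ?thesis by simp
qed

abbreviation br :: "nat \<Rightarrow> real \<Rightarrow> real" where
  "br \<equiv> branch l r G"

lemma br_in_J: "1 \<le> i \<Longrightarrow> z \<in> ambient \<Longrightarrow> br i z \<in> J l r i"
  and G_br: "1 \<le> i \<Longrightarrow> z \<in> ambient \<Longrightarrow> G (br i z) = z"
  unfolding branch_def using G_image by (auto intro: inv_into_into f_inv_into_f)

lemma br_in_ambient: "1 \<le> i \<Longrightarrow> z \<in> ambient \<Longrightarrow> br i z \<in> ambient"
  using br_in_J J_subset_ambient by blast

lemma br_nonexpanding:
  "1 \<le> i \<Longrightarrow> z \<in> ambient \<Longrightarrow> z' \<in> ambient \<Longrightarrow> \<bar>br i z - br i z'\<bar> \<le> \<bar>z - z'\<bar>"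
  using J_expansion[of i "br i z" "br i z'"] br_in_J G_br by simp

lemma br_G: assumes "1 \<le> i" "x \<in> J l r i" shows "br i (G x) = x"
proof -
  have "G x \<in> ambient" using G_image assms by blast
  then show ?thesis using J_expansion[OF assms(1) br_in_J assms(2)] G_br assms(1) by fastforce
qed

text \<open>
  On the compact set \<open>br 2 ` {l 2..r 2}\<close>, which is contained in \<open>J 2\<close>, the derivative of \<open>G\<close> is
  bounded away from \<open>1\<close> in absolute value.
\<close>

lemma br2_contraction:
  obtains \<kappa> where "0 \<le> \<kappa>" "\<kappa> < 1"
    "\<And>z z'. z \<in> {l 2..r 2} \<Longrightarrow> z' \<in> {l 2..r 2} \<Longrightarrow> \<bar>br 2 z - br 2 z'\<bar> \<le> \<kappa> * \<bar>z - z'\<bar>"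
proof -
  define C where "C = br 2 ` {l 2..r 2}"
  have "continuous_on ambient (br 2)"
    unfolding continuous_on_iff dist_real_def
  proof (intro ballI allI impI)
    fix z and e :: real assume "z \<in> ambient" "0 < e"
    then show "\<exists>d>0. \<forall>z'\<in>ambient. \<bar>z' - z\<bar> < d \<longrightarrow> \<bar>br 2 z' - br 2 z\<bar> < e"
      by (intro exI[of _ e]) (auto intro: le_less_trans[OF br_nonexpanding])
  qed
  then have "continuous_on {l 2..r 2} (br 2)"
    using cl_J2(4) continuous_on_subset by blast
  then have C: "compact C" "connected C"
    unfolding C_def by (auto intro: compact_continuous_image connected_continuous_image)
  have "C \<noteq> {}" using cl_J2 by (auto simp: C_def)
  have CS: "C \<subseteq> S l r"
  proof
    fix y assume "y \<in> C"
    then obtain z where "z \<in> {l 2..r 2}" "y = br 2 z" unfolding C_def by blast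
    then have "y \<in> J l r 2" using cl_J2(4) br_in_J[of 2 z] by auto
    then show "y \<in> S l r" using J_subset_S[of 2] by auto
  qed
  have "continuous_on C (\<lambda>x. \<bar>deriv G x\<bar>)"
    using continuous_on_deriv_G CS by (intro continuous_intros) (rule continuous_on_subset)
  then obtain c where c: "c \<in> C" "\<And>x. x \<in> C \<Longrightarrow> \<bar>deriv G c\<bar> \<le> \<bar>deriv G x\<bar>"
    using continuous_attains_inf[OF C(1) \<open>C \<noteq> {}\<close>] by blast
  define m where "m = \<bar>deriv G c\<bar>"
  have m: "m > 1" using expanding c(1) CS by (auto simp: m_def)
  have "\<bar>br 2 z - br 2 z'\<bar> \<le> (1 / m) * \<bar>z - z'\<bar>" if "z \<in> {l 2..r 2}" "z' \<in> {l 2..r 2}" for z z'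
  proof -
    have "{min (br 2 z) (br 2 z')..max (br 2 z) (br 2 z')} \<subseteq> C"
      using that by (intro connected_contains_Icc[OF C(2)]) (auto simp: C_def min_def max_def)
    then have "m * \<bar>br 2 z - br 2 z'\<bar> \<le> \<bar>G (br 2 z) - G (br 2 z')\<bar>"
      using CS c(2) by (intro expansion) (auto simp: m_def)
    also have "\<dots> = \<bar>z - z'\<bar>" using that cl_J2(4) G_br[of 2] by (metis one_le_numeral subsetD)
    finally show ?thesis using m by (simp add: field_simps)
  qed
  with m show ?thesis by (intro that[of "1 / m"]) auto
qed

lemma ex_pivot: "\<exists>x. x \<in> J l r 2 \<and> G x = x"
proof -
  obtain \<kappa> where \<kappa>: "0 \<le> \<kappa>" "\<kappa> < 1"
    "\<And>z z'. z \<in> {l 2..r 2} \<Longrightarrow> z' \<in> {l 2..r 2} \<Longrightarrow> \<bar>br 2 z - br 2 z'\<bar> \<le> \<kappa> * \<bar>z - z'\<bar>"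
    using br2_contraction by blast
  have "\<exists>!x\<in>{l 2..r 2}. br 2 x = x"
  proof (rule Banach_fix[OF _ _ \<kappa>(1,2)])
    show "complete {l 2..r 2}" by (simp add: complete_eq_closed)
    show "{l 2..r 2} \<noteq> {}" using cl_J2 by simp
    show "br 2 ` {l 2..r 2} \<subseteq> {l 2..r 2}"
      using br_in_J[of 2] cl_J2(4) J2_subset by force
    show "dist (br 2 x) (br 2 y) \<le> \<kappa> * dist x y" if "x \<in> {l 2..r 2}" "y \<in> {l 2..r 2}" for x y
      using \<kappa>(3) that by (simp add: dist_real_def)
  qed
  then obtain x where "x \<in> {l 2..r 2}" "br 2 x = x" by blast
  then show ?thesis using br_in_J[of 2 x] G_br[of 2 x] cl_J2(4) by (intro exI[of _ x]) auto
qed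

text \<open>The fixed point \<open>[2, 2, 2, \<dots>]\<close>.\<close>

definition pivot :: real where
  "pivot = (SOME x. x \<in> J l r 2 \<and> G x = x)"

lemma pivot_J2: "pivot \<in> J l r 2" and G_pivot: "G pivot = pivot"
  using someI_ex[OF ex_pivot] by (auto simp: pivot_def)

lemma pivot_cl: "pivot \<in> {l 2..r 2}" using pivot_J2 J2_subset by blast

lemma pivot_S: "pivot \<in> S l r" using pivot_J2 J_subset_S[of 2] by auto

lemma pivot_ambient: "pivot \<in> ambient" using pivot_S S_subset_ambient by blast

lemma br_pivot: "br 2 pivot = pivot"
  using br_G[of 2 pivot] pivot_J2 G_pivot by simp

lemma funpow_pivot: "(G ^^ j) pivot = pivot"
  by (induction j) (auto simp: G_pivot)

lemma LambdaD: "x \<in> Lambda l r G \<Longrightarrow> (G ^^ j) x \<in> S l r"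
  by (auto simp: Lambda_def)

lemma Lambda_01: "x \<in> Lambda l r G \<Longrightarrow> 0 < (G ^^ j) x" "x \<in> Lambda l r G \<Longrightarrow> (G ^^ j) x < 1"
  using LambdaD[of x j] S_subset by auto

text \<open>The set on which the first \<open>k\<close> iterates of \<open>G\<close> are defined.\<close>

definition dom_iter :: "nat \<Rightarrow> real set" where
  "dom_iter k = {x. \<forall>j<k. (G ^^ j) x \<in> S l r}"

lemma Lambda_eq: "x \<in> Lambda l r G \<longleftrightarrow> (\<forall>k. x \<in> dom_iter k)"
  by (auto simp: Lambda_def dom_iter_def)

lemma open_dom_iter: "open (dom_iter k)"
proof (induction k)
  case 0
  then show ?case by (simp add: dom_iter_def)
next
  case (Suc k)
  have "dom_iter (Suc k) = S l r \<inter> G -` dom_iter k"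
    unfolding dom_iter_def All_less_Suc2 by (auto simp: funpow_swap1)
  moreover have "continuous_on (S l r) G"
    using isCont_G by (simp add: continuous_at_imp_continuous_on)
  ultimately show ?case
    using continuous_open_preimage[OF _ open_S Suc.IH] by simp
qed

lemma isCont_funpow:
  assumes "x \<in> Lambda l r G"
  shows "isCont (G ^^ j) x"
proof (induction j)
  case 0
  then show ?case by (simp add: id_def)
next
  case (Suc j)
  then show ?case
    using isCont_G[OF LambdaD[OF assms]] by (simp add: isCont_o2 comp_def)
qed

text \<open>
  Along the branches that the orbit of \<open>x\<close> takes, every \<open>z\<close> in \<^term>\<open>ambient\<close> has a preimage
  under \<open>G ^^ q\<close>; the inverse branches do not increase distances.
\<close>

lemma pullback:
  assumes "x \<in> ambient" "\<And>j. j < q \<Longrightarrow> (G ^^ j) x \<in> S l r" "z \<in> ambient"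
  shows "\<exists>y\<in>ambient. (\<forall>j<q. (G ^^ j) y \<in> S l r) \<and> (G ^^ q) y = z \<and> \<bar>y - x\<bar> \<le> \<bar>z - (G ^^ q) x\<bar>"
  using assms
proof (induction q arbitrary: x)
  case 0
  then show ?case by (intro bexI[of _ z]) auto
next
  case (Suc q)
  from Suc.prems(2)[of 0] obtain i where i: "1 \<le> i" "x \<in> J l r i" by (auto simp: S_def)
  then have Gx: "G x \<in> ambient" using G_image by blast
  have "(G ^^ j) (G x) \<in> S l r" if "j < q" for j
    using Suc.prems(2)[of "Suc j"] that by (simp add: funpow_swap1)
  from Suc.IH[OF Gx this Suc.prems(3)] obtain y
    where y: "y \<in> ambient" "\<forall>j<q. (G ^^ j) y \<in> S l r" "(G ^^ q) y = z"
      "\<bar>y - G x\<bar> \<le> \<bar>z - (G ^^ q) (G x)\<bar>" by auto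
  have Gbr: "G (br i y) = y" by (rule G_br[OF i(1) y(1)])
  have "br i y \<in> S l r" using br_in_J[OF i(1) y(1)] J_subset_S[OF i(1)] by blast
  then have "\<forall>j<Suc q. (G ^^ j) (br i y) \<in> S l r"
    unfolding All_less_Suc2 using y(2) Gbr by (simp add: funpow_swap1)
  moreover have "\<bar>br i y - x\<bar> \<le> \<bar>y - G x\<bar>"
    using br_nonexpanding[OF i(1) y(1) Gx] br_G[OF i] by simp
  ultimately show ?case
    using y(3,4) Gbr br_in_ambient[OF i(1) y(1)] by (intro bexI[of _ "br i y"]) (auto simp: funpow_swap1)
qed

lemma funpow_br2: assumes "a \<in> ambient" shows "(br 2 ^^ n) a \<in> ambient" "(br 2 ^^ Suc n) a \<in> J l r 2"
proof -
  show 1: "(br 2 ^^ n) a \<in> ambient" for n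
    by (induction n) (use assms br_in_ambient[of 2] in auto)
  show "(br 2 ^^ Suc n) a \<in> J l r 2"
    using br_in_J[OF _ 1[of n], of 2] by simp
qed

lemma funpow_G_br2:
  assumes "a \<in> ambient"
  shows "k \<le> p \<Longrightarrow> (G ^^ k) ((br 2 ^^ p) a) = (br 2 ^^ (p - k)) a"
proof (induction k)
  case (Suc k)
  then have "p - k = Suc (p - Suc k)" by simp
  then have "(G ^^ Suc k) ((br 2 ^^ p) a) = G (br 2 ((br 2 ^^ (p - Suc k)) a))"
    using Suc by simp
  also have "\<dots> = (br 2 ^^ (p - Suc k)) a"
    by (rule G_br) (use funpow_br2[OF assms] in auto)
  finally show ?case .
qed simp

text \<open>
  If \<open>x = [w, 2, 2, \<dots>]\<close> with \<open>w\<close> of length \<open>q\<close>, then \<open>y = [w, 2, \<dots>, 2, N, 2, 2, \<dots>]\<close>, where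
  the finite block has \<open>Suc p\<close> twos, is close to \<open>x\<close> uniformly in \<open>N\<close>.
\<close>

lemma excursion:
  assumes \<kappa>: "0 \<le> \<kappa>" "\<And>z z'. z \<in> {l 2..r 2} \<Longrightarrow> z' \<in> {l 2..r 2} \<Longrightarrow> \<bar>br 2 z - br 2 z'\<bar> \<le> \<kappa> * \<bar>z - z'\<bar>"
    and x: "x \<in> Lambda l r G" "(G ^^ q) x = pivot" and N: "1 \<le> N"
  shows "\<exists>y\<in>Lambda l r G. \<bar>y - x\<bar> \<le> \<kappa> ^ p \<and>
           (\<forall>j\<le>Suc p. (G ^^ (q + j)) y = (br 2 ^^ (Suc p - j)) (br N pivot)) \<and>
           (\<forall>j>q + Suc p. (G ^^ j) y = pivot)"
proof -
  define a where "a = br N pivot"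
  have a: "a \<in> J l r N" "a \<in> ambient" "G a = pivot"
    unfolding a_def using br_in_J G_br br_in_ambient N pivot_ambient by auto
  have close: "\<bar>(br 2 ^^ Suc p) a - pivot\<bar> \<le> \<kappa> ^ p"
  proof (induction p)
    case 0
    have "(br 2 ^^ Suc 0) a \<in> {0<..<1}" "pivot \<in> {0<..<1}"
      using funpow_br2(1)[OF a(2)] pivot_ambient ambient_subset by blast+
    then show ?case by auto
  next
    case (Suc p)
    have "\<bar>br 2 ((br 2 ^^ Suc p) a) - br 2 pivot\<bar> \<le> \<kappa> * \<bar>(br 2 ^^ Suc p) a - pivot\<bar>"
      using funpow_br2(2)[OF a(2), of p] J2_subset pivot_cl by (intro \<kappa>(2)) blast+
    also have "\<dots> \<le> \<kappa> * \<kappa> ^ p" by (intro mult_left_mono Suc \<kappa>(1))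
    finally show ?case by (simp add: br_pivot)
  qed
  have "x \<in> ambient" using LambdaD[OF x(1), of 0] S_subset_ambient by auto
  from pullback[OF this LambdaD[OF x(1)] funpow_br2(1)[OF a(2), of "Suc p"], of q] obtain y
    where y: "\<And>j. j < q \<Longrightarrow> (G ^^ j) y \<in> S l r" "(G ^^ q) y = (br 2 ^^ Suc p) a"
      "\<bar>y - x\<bar> \<le> \<bar>(br 2 ^^ Suc p) a - pivot\<bar>" unfolding x(2) by blast
  have mid: "(G ^^ (q + j)) y = (br 2 ^^ (Suc p - j)) a" if "j \<le> Suc p" for j
    using funpow_G_br2[OF a(2) that] y(2) by (metis add.commute comp_apply funpow_add)
  have late: "(G ^^ j) y = pivot" if "j > q + Suc p" for j
  proof -
    define k where "k = j - Suc (q + Suc p)"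
    have "j = k + Suc (q + Suc p)"
      using that by (simp add: k_def)
    then have "(G ^^ j) y = (G ^^ k) (G ((G ^^ (q + Suc p)) y))"
      by (simp only: funpow_add funpow.simps comp_apply)
    also have "\<dots> = pivot" using mid[of "Suc p"] a(3) funpow_pivot by simp
    finally show ?thesis .
  qed
  have "(G ^^ j) y \<in> S l r" for j
  proof -
    consider "j < q" | "q \<le> j" "j < q + Suc p" | "j = q + Suc p" | "j > q + Suc p" by linarith
    then show ?thesis
    proof cases
      case 2
      then obtain i where i: "j = q + i" "i \<le> p" by (metis add_le_cancel_left le_Suc_ex less_Suc_eq_le add_Suc_right)
      then have "(G ^^ j) y = (br 2 ^^ Suc (p - i)) a" using mid[of i] by (simp add: Suc_diff_le)
      then show ?thesis using funpow_br2(2)[OF a(2), of "p - i"] J_subset_S[of 2] by auto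
    next
      case 3
      then show ?thesis using mid[of "Suc p"] a(1) J_subset_S[OF N] by auto
    qed (use y(1) late pivot_S in auto)
  qed
  then have "y \<in> Lambda l r G" by (simp add: Lambda_def)
  then show ?thesis using y(3) close mid late unfolding a_def by (intro bexI[of _ y]) auto
qed

end


section \<open>The series along an orbit\<close>

lemma prod_lessThan_add: "(\<Prod>j<q + p. f j) = (\<Prod>j<q. f j) * (\<Prod>j<p. f (q + j :: nat) :: 'a :: comm_monoid_mult)"
  by (induction p) (auto simp: mult.assoc)

lemma isCont_abs_less:
  fixes h :: "real \<Rightarrow> real"
  assumes "isCont h x" "e > 0"
  shows "\<exists>d>0. \<forall>y. \<bar>y - x\<bar> < d \<longrightarrow> \<bar>h y - h x\<bar> < e"
  using assms unfolding continuous_at_eps_delta dist_real_def by blast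

text \<open>
  A full branch map together with a positive continuous function \<open>u\<close> that is infinite at \<open>s0\<close>, an
  exponent and a choice of signs.
\<close>

locale weighted_branch_map = full_branch_map +
  fixes u :: "real \<Rightarrow> real" and \<nu> :: real and s :: "nat \<Rightarrow> real"
  assumes u_pos: "x \<in> ambient \<Longrightarrow> u x > 0"
    and isCont_u: "x \<in> ambient \<Longrightarrow> isCont u x"
    and u_infinity: "filterlim u at_top (at_right (s0 l r))"
    and \<nu>_pos: "\<nu> > 0"
    and signs: "1 \<le> i \<Longrightarrow> s i \<in> {-1, 1}"
begin

text \<open>The terms of the series, numbered from \<open>0\<close>.\<close>

abbreviation T :: "nat \<Rightarrow> real \<Rightarrow> real" where
  "T i x \<equiv> Phi_term G u \<nu> s x (Suc i)"

text \<open>The factor of the \<open>i\<close>-th term that is raised to the power \<open>\<nu>\<close>; \<open>\<eta>\<^sub>0 = 1\<close> is left out.\<close>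

definition weight :: "nat \<Rightarrow> real \<Rightarrow> real" where
  "weight i x = (\<Prod>j<i. (G ^^ j) x)"

lemma T_eq: "T i x = s (Suc i) * weight i x powr \<nu> * u ((G ^^ i) x)"
  unfolding Phi_term_def weight_def prod.lessThan_Suc_shift by (simp add: eta_def)

lemma weight_pos: "x \<in> Lambda l r G \<Longrightarrow> weight i x > 0"
  unfolding weight_def by (intro prod_pos) (auto simp: Lambda_01)

lemma u_funpow_pos: "x \<in> Lambda l r G \<Longrightarrow> u ((G ^^ i) x) > 0"
  using u_pos LambdaD S_subset_ambient by blast

lemma abs_T: assumes "x \<in> Lambda l r G" shows "\<bar>T i x\<bar> = weight i x powr \<nu> * u ((G ^^ i) x)"
proof -
  have "\<bar>s (Suc i)\<bar> = 1" using signs[of "Suc i"] by auto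
  then show ?thesis
    unfolding T_eq using weight_pos[OF assms] u_funpow_pos[OF assms, of i] by (simp add: abs_mult)
qed

lemma isCont_weight: assumes "x \<in> Lambda l r G" shows "isCont (weight i) x"
  unfolding weight_def by (intro continuous_intros isCont_funpow[OF assms])

lemma isCont_T: assumes "x \<in> Lambda l r G" shows "isCont (T i) x"
proof -
  have "isCont (\<lambda>y. u ((G ^^ i) y)) x"
    using LambdaD[OF assms, of i] S_subset_ambient by (intro isCont_o2[OF isCont_funpow[OF assms] isCont_u]) auto
  then show ?thesis
    unfolding T_eq using isCont_weight[OF assms] weight_pos[OF assms, of i]
    by (intro continuous_intros) auto
qed

text \<open>The rate at which terms decay while the orbit stays in \<open>{l 2..r 2}\<close>.\<close>

definition \<rho> :: real where "\<rho> = r 2 powr \<nu>"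

lemma \<rho>_bounds: "0 < \<rho>" "\<rho> < 1"
  using cl_J2(1-3) \<nu>_pos powr_less_mono2[of \<nu> "r 2" 1] unfolding \<rho>_def by auto

text \<open>
  One visit outside \<open>{l 2..r 2}\<close>, at time \<open>K\<close>, costs the bound at most one factor \<open>r 2\<close>, since all
  orbit points are below \<open>1\<close>.
\<close>

lemma weight_le:
  assumes y: "y \<in> Lambda l r G" and K: "\<And>j. q \<le> j \<Longrightarrow> j \<noteq> K \<Longrightarrow> (G ^^ j) y \<in> {l 2..r 2}"
  shows "weight i y \<le> r 2 ^ (i - Suc q)"
proof -
  define A where "A = {q..<i} - {K}"
  have "weight i y = (\<Prod>j\<in>{..<i} - A. (G ^^ j) y) * (\<Prod>j\<in>A. (G ^^ j) y)"
    unfolding weight_def by (rule prod.subset_diff) (auto simp: A_def)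
  also have "\<dots> \<le> 1 * (\<Prod>j\<in>A. r 2)"
    using Lambda_01[OF y] K
    by (intro mult_mono prod_le_1 prod_mono prod_nonneg) (auto simp: A_def intro: less_imp_le)
  also have "\<dots> = r 2 ^ card A" by simp
  also have "\<dots> \<le> r 2 ^ (i - Suc q)"
    using cl_J2 by (intro power_decreasing) (auto simp: A_def card_Diff_singleton_if)
  finally show ?thesis .
qed

lemma r2_power_powr: "(r 2 ^ n) powr \<nu> = \<rho> ^ n"
proof -
  have "r 2 > 0" using cl_J2 by linarith
  then have "(r 2 ^ n) powr \<nu> = (r 2 powr real n) powr \<nu>" by (simp add: powr_realpow)
  also have "\<dots> = \<rho> ^ n"
    unfolding \<rho>_def using \<open>r 2 > 0\<close> by (simp add: powr_powr powr_power mult.commute)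
  finally show ?thesis .
qed

text \<open>
  The bound does not involve the orbit point at time \<open>K\<close>, but it says nothing about the term \<open>K\<close>
  itself, in which \<open>u\<close> may be arbitrarily large.
\<close>

lemma T_le:
  assumes y: "y \<in> Lambda l r G" and K: "\<And>j. q \<le> j \<Longrightarrow> j \<noteq> K \<Longrightarrow> (G ^^ j) y \<in> {l 2..r 2}"
    and u: "\<And>z. z \<in> {l 2..r 2} \<Longrightarrow> u z \<le> V"
    and i: "q \<le> i" "i \<noteq> K"
  shows "\<bar>T i y\<bar> \<le> V * \<rho> ^ (i - Suc q)"
proof -
  have "weight i y powr \<nu> \<le> (r 2 ^ (i - Suc q)) powr \<nu>"
    using weight_le[OF y K] weight_pos[OF y, of i] \<nu>_pos by (intro powr_mono2) auto
  moreover have "u ((G ^^ i) y) \<le> V" using u K i by blast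
  ultimately have "weight i y powr \<nu> * u ((G ^^ i) y) \<le> \<rho> ^ (i - Suc q) * V"
    using u_funpow_pos[OF y, of i] \<rho>_bounds unfolding r2_power_powr by (intro mult_mono) auto
  then show ?thesis unfolding abs_T[OF y] by (simp add: mult.commute)
qed

lemma u_bounded: obtains V where "V > 0" "\<And>z. z \<in> {l 2..r 2} \<Longrightarrow> u z \<le> V"
proof -
  have "continuous_on {l 2..r 2} u"
    using isCont_u cl_J2(4) by (meson continuous_at_imp_continuous_on subsetD)
  then obtain c where c: "c \<in> {l 2..r 2}" "\<And>z. z \<in> {l 2..r 2} \<Longrightarrow> u z \<le> u c"
    using continuous_attains_sup[of "{l 2..r 2}" u] cl_J2(2) by auto
  have "u c > 0" using c(1) cl_J2(4) u_pos by blast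
  then show ?thesis using c(2) that by blast
qed

lemma summable_geometric_tail: "summable (\<lambda>i. V * \<rho> ^ (i - Suc q))"
proof -
  have "summable (\<lambda>i. V * \<rho> ^ ((i + Suc q) - Suc q))"
    using \<rho>_bounds by (auto intro!: summable_mult summable_geometric)
  then show ?thesis by (subst (asm) summable_iff_shift)
qed

text \<open>The points whose orbits end in the fixed point.\<close>

definition pivot_preimages :: "real set" where
  "pivot_preimages = {x \<in> Lambda l r G. \<exists>q. (G ^^ q) x = pivot}"

lemma funpow_after_pivot:
  assumes "(G ^^ q) x = pivot" "q \<le> j"
  shows "(G ^^ j) x = pivot"
proof -
  obtain k where "j = k + q" using assms(2) by (metis le_add_diff_inverse2)
  then show ?thesis using assms(1) funpow_pivot by (simp add: funpow_add)
qed

lemma summable_T: assumes "x \<in> pivot_preimages" shows "summable (\<lambda>i. T i x)"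
proof -
  obtain q where x: "x \<in> Lambda l r G" "(G ^^ q) x = pivot"
    using assms by (auto simp: pivot_preimages_def)
  obtain V where V: "V > 0" "\<And>z. z \<in> {l 2..r 2} \<Longrightarrow> u z \<le> V" using u_bounded by blast
  show ?thesis
  proof (rule summable_comparison_test'[OF summable_geometric_tail])
    show "norm (T i x) \<le> V * \<rho> ^ (i - Suc (Suc q))" if "Suc q \<le> i" for i
      using T_le[OF x(1), of "Suc q" q V i] V(2) that funpow_after_pivot[OF x(2)] pivot_cl by auto
  qed
qed

text \<open>
  The perturbation: \<open>x = [w, 2, 2, \<dots>]\<close> is changed to \<open>y = [w, 2, \<dots>, 2, N, 2, 2, \<dots>]\<close>.  Only the
  term of the digit \<open>N\<close> changes substantially.  First \<open>N\<close> is chosen so large that this term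
  exceeds \<open>\<epsilon> / 2\<close> when \<open>N\<close> stands at the earliest admissible place; then the block of twos is
  prolonged until the term is at most \<open>\<epsilon> / 2\<close>.  Each further two reduces it by at most a fixed
  factor, so the term ends up comparable to \<open>\<epsilon>\<close>.
\<close>

lemma pivot_preimages_perturb:
  assumes "x \<in> pivot_preimages" and \<epsilon>: "\<epsilon> > 0" and \<delta>: "\<delta> > 0"
  shows "\<exists>y\<in>pivot_preimages. \<bar>y - x\<bar> < \<delta> \<and> (\<forall>m. \<bar>(\<Sum>i<m. T i y) - (\<Sum>i<m. T i x)\<bar> \<le> \<epsilon>) \<and>
           ((l 2 / 2) powr \<nu> / 4) * \<epsilon> \<le> \<bar>(\<Sum>i. T i y) - (\<Sum>i. T i x)\<bar>"
proof -
  obtain q where x: "x \<in> Lambda l r G" "(G ^^ q) x = pivot"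
    using assms by (auto simp: pivot_preimages_def)
  obtain V where V: "V > 0" "\<And>z. z \<in> {l 2..r 2} \<Longrightarrow> u z \<le> V" using u_bounded by blast
  obtain \<kappa> where \<kappa>: "0 \<le> \<kappa>" "\<kappa> < 1"
    "\<And>z z'. z \<in> {l 2..r 2} \<Longrightarrow> z' \<in> {l 2..r 2} \<Longrightarrow> \<bar>br 2 z - br 2 z'\<bar> \<le> \<kappa> * \<bar>z - z'\<bar>"
    using br2_contraction by blast
  define c where "c = (l 2 / 2) powr \<nu>"
  have c: "0 < c" "c \<le> 1"
    using cl_J2 \<nu>_pos unfolding c_def by (auto intro!: powr_le1)
  define \<eta> where "\<eta> = c * (\<epsilon> / 2) / 2"
  have \<eta>: "0 < \<eta>" "\<eta> \<le> \<epsilon> / 2"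
    using c \<epsilon> unfolding \<eta>_def by (auto simp: field_simps intro: order_trans[OF mult_right_mono[of c 1 \<epsilon>]])
  define g where "g i = 2 * V * \<rho> ^ (i - Suc q)" for i
  have g0: "0 \<le> g i" for i using V(1) \<rho>_bounds by (simp add: g_def)
  have "summable g" unfolding g_def by (rule summable_geometric_tail)
  then obtain i1 where i1: "\<And>m n. i1 \<le> m \<Longrightarrow> \<bar>sum g {m..<n}\<bar> < \<eta> / 2"
    using \<eta>(1) unfolding summable_Cauchy by (metis half_gt_zero real_norm_def)
  define i0 where "i0 = max i1 (Suc q)"
  \<comment> \<open>Close to \<open>x\<close> the first \<open>i0\<close> terms and the weight of the word \<open>w\<close> hardly change.\<close>
  define h where "h y = (\<Sum>i<i0. \<bar>T i y - T i x\<bar>)" for y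
  have "isCont h x"
    unfolding h_def by (intro continuous_intros isCont_T[OF x(1)])
  from isCont_abs_less[OF this, of "\<eta> / 2"] \<eta>(1) obtain \<delta>1
    where \<delta>1: "\<delta>1 > 0" "\<And>y. \<bar>y - x\<bar> < \<delta>1 \<Longrightarrow> h y < \<eta> / 2"
    by (auto simp: h_def)
  define w where "w = weight q x"
  have w: "w > 0" unfolding w_def by (rule weight_pos[OF x(1)])
  from isCont_abs_less[OF isCont_weight[OF x(1)], of "w / 3" q] w obtain \<delta>2
    where \<delta>2: "\<delta>2 > 0" "\<And>y. \<bar>y - x\<bar> < \<delta>2 \<Longrightarrow> \<bar>weight q y - w\<bar> < w / 3"
    by (auto simp: w_def)
  have "min \<delta> (min \<delta>1 \<delta>2) > 0" using \<delta> \<delta>1 \<delta>2 by simp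
  from real_arch_pow_inv[OF this \<kappa>(2)] obtain p1 where p1: "\<kappa> ^ p1 < min \<delta> (min \<delta>1 \<delta>2)" by blast
  define p0 where "p0 = max p1 i0"
  have "\<exists>Y. \<forall>N p. 1 \<le> N \<longrightarrow> Y N p \<in> Lambda l r G \<and> \<bar>Y N p - x\<bar> \<le> \<kappa> ^ p \<and>
           (\<forall>j\<le>Suc p. (G ^^ (q + j)) (Y N p) = (br 2 ^^ (Suc p - j)) (br N pivot)) \<and>
           (\<forall>j>q + Suc p. (G ^^ j) (Y N p) = pivot)"
    using excursion[OF \<kappa>(1,3) x] by (intro choice allI) (meson)
  then obtain Y where Y: "\<And>N p. 1 \<le> N \<Longrightarrow> Y N p \<in> Lambda l r G"
    "\<And>N p. 1 \<le> N \<Longrightarrow> \<bar>Y N p - x\<bar> \<le> \<kappa> ^ p"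
    "\<And>N p j. 1 \<le> N \<Longrightarrow> j \<le> Suc p \<Longrightarrow> (G ^^ (q + j)) (Y N p) = (br 2 ^^ (Suc p - j)) (br N pivot)"
    "\<And>N p j. 1 \<le> N \<Longrightarrow> q + Suc p < j \<Longrightarrow> (G ^^ j) (Y N p) = pivot"
    by blast
  have near: "\<bar>Y N p - x\<bar> < \<delta>" "\<bar>Y N p - x\<bar> < \<delta>1" "\<bar>Y N p - x\<bar> < \<delta>2" if "1 \<le> N" "p0 \<le> p" for N p
  proof -
    have "\<kappa> ^ p \<le> \<kappa> ^ p1" using \<kappa>(1,2) that(2) by (intro power_decreasing) (auto simp: p0_def)
    then show "\<bar>Y N p - x\<bar> < \<delta>" "\<bar>Y N p - x\<bar> < \<delta>1" "\<bar>Y N p - x\<bar> < \<delta>2"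
      using p1 Y(2)[OF that(1), of p] by auto
  qed
  \<comment> \<open>\<open>R N p\<close> is the contribution of the block of \<open>Suc p\<close> twos to the weight, \<open>A N p\<close> the
      absolute value of the term of the digit \<open>N\<close>.\<close>
  define R where "R N p = (\<Prod>j<Suc p. (br 2 ^^ (Suc p - j)) (br N pivot))" for N p
  have weight_Y: "weight (q + Suc p) (Y N p) = weight q (Y N p) * R N p" if "1 \<le> N" for N p
    unfolding weight_def R_def prod_lessThan_add using Y(3)[OF that] by simp
  have br2_J2: "(br 2 ^^ Suc k) (br N pivot) \<in> J l r 2" if "1 \<le> N" for N k
    using funpow_br2(2)[OF br_in_ambient[OF that pivot_ambient]] .
  have R_Suc: "R N (Suc p) = (br 2 ^^ Suc (Suc p)) (br N pivot) * R N p" for N p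
    unfolding R_def by (subst prod.lessThan_Suc_shift) simp
  have R_lower: "l 2 ^ Suc p \<le> R N p" if "1 \<le> N" for N p
  proof -
    have "(\<Prod>j<Suc p. l 2) \<le> R N p"
      unfolding R_def
    proof (rule prod_mono)
      fix j assume "j \<in> {..<Suc p}"
      then have "Suc p - j = Suc (p - j)" by auto
      then show "0 \<le> l 2 \<and> l 2 \<le> (br 2 ^^ (Suc p - j)) (br N pivot)"
        using br2_J2[OF that, of "p - j"] cl_J2(1) by (auto simp: J_def)
    qed
    then show ?thesis by simp
  qed
  have R_pos: "0 < R N p" if "1 \<le> N" for N p
    using less_le_trans[OF zero_less_power[OF cl_J2(1)] R_lower[OF that]] .
  define A where "A N p = weight (q + Suc p) (Y N p) powr \<nu> * u (br N pivot)" for N p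
  have u_br: "0 < u (br N pivot)" if "1 \<le> N" for N
    using u_pos br_in_ambient[OF that pivot_ambient] by blast
  have wY: "2 / 3 * w \<le> weight q (Y N p)" "weight q (Y N p) \<le> 4 / 3 * w" if "1 \<le> N" "p0 \<le> p" for N p
    using \<delta>2(2)[OF near(3)[OF that]] by linarith+
  \<comment> \<open>Prolonging the block adds a factor \<open>\<ge> l 2\<close> to the weight; the factor \<open>1 / 2\<close> makes up for the
      change in the weight of \<open>w\<close>.\<close>
  have A_Suc: "c * A N p \<le> A N (Suc p)" if N: "1 \<le> N" "p0 \<le> p" for N p
  proof -
    have "l 2 / 2 * weight (q + Suc p) (Y N p) \<le> l 2 / 2 * (4 / 3 * w * R N p)"
      unfolding weight_Y[OF N(1)] using cl_J2(1) R_pos[OF N(1), of p] wY(2)[OF N]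
      by (intro mult_left_mono mult_right_mono) auto
    also have "\<dots> = 2 / 3 * w * (l 2 * R N p)" by simp
    also have "\<dots> \<le> weight q (Y N (Suc p)) * ((br 2 ^^ Suc (Suc p)) (br N pivot) * R N p)"
      using wY(1)[OF N(1), of "Suc p"] N(2) w cl_J2(1) R_pos[OF N(1), of p] br2_J2[OF N(1), of "Suc p"]
      by (intro mult_mono mult_right_mono) (auto simp: J_def)
    also have "\<dots> = weight (q + Suc (Suc p)) (Y N (Suc p))"
      unfolding weight_Y[OF N(1)] R_Suc ..
    finally have "(l 2 / 2 * weight (q + Suc p) (Y N p)) powr \<nu> \<le> weight (q + Suc (Suc p)) (Y N (Suc p)) powr \<nu>"
      using \<nu>_pos cl_J2(1) weight_pos[OF Y(1)[OF N(1)], of "q + Suc p" p] by (intro powr_mono2) auto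
    moreover have "(l 2 / 2 * weight (q + Suc p) (Y N p)) powr \<nu> = c * weight (q + Suc p) (Y N p) powr \<nu>"
      unfolding c_def
      by (rule powr_mult; use cl_J2(1) weight_pos[OF Y(1)[OF N(1)], of "q + Suc p" p] in simp)
    ultimately have "c * weight (q + Suc p) (Y N p) powr \<nu> \<le> weight (q + Suc (Suc p)) (Y N (Suc p)) powr \<nu>"
      by simp
    from mult_right_mono[OF this less_imp_le[OF u_br[OF N(1)]]] show ?thesis
      by (simp add: A_def mult.assoc)
  qed
  \<comment> \<open>At the place given by \<open>p0\<close>, the term is large for some \<open>N\<close>, because \<open>u\<close> is infinite at \<open>s0\<close>.\<close>
  obtain N where N: "1 \<le> N" "\<epsilon> / 2 < A N p0"
  proof -
    define b where "b = (2 / 3 * w * l 2 ^ Suc p0) powr \<nu>"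
    have b: "b > 0" using w cl_J2(1) by (simp add: b_def)
    have "eventually (\<lambda>z. \<epsilon> / 2 / b < u z) (at_right (s0 l r))"
      using u_infinity by (simp add: filterlim_at_top_dense)
    then obtain t where t: "t > s0 l r" "\<And>z. s0 l r < z \<Longrightarrow> z < t \<Longrightarrow> \<epsilon> / 2 / b < u z"
      unfolding eventually_at_right_field by blast
    from J_near_s0[OF t(1)] obtain N where N: "1 \<le> N" "J l r N \<subseteq> {s0 l r <..< t}" by blast
    then have "\<epsilon> / 2 / b < u (br N pivot)"
      using br_in_J[OF N(1) pivot_ambient] t(2) by auto
    then have "\<epsilon> / 2 < b * u (br N pivot)" using b by (simp add: field_simps)
    also have "\<dots> \<le> A N p0"
    proof -
      have "2 / 3 * w * l 2 ^ Suc p0 \<le> weight (q + Suc p0) (Y N p0)"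
        unfolding weight_Y[OF N(1)] using wY(1)[OF N(1), of p0] R_lower[OF N(1), of p0] w cl_J2(1)
        by (intro mult_mono) auto
      then have "b \<le> weight (q + Suc p0) (Y N p0) powr \<nu>"
        unfolding b_def using w cl_J2(1) \<nu>_pos by (intro powr_mono2) auto
      then show ?thesis
        unfolding A_def using u_br[OF N(1)] by (intro mult_right_mono) auto
    qed
    finally show ?thesis using that N(1) by blast
  qed
  have Y_cl: "(G ^^ j) (Y N p) \<in> {l 2..r 2}" if "q \<le> j" "j \<noteq> q + Suc p" for j p
  proof (cases "j < q + Suc p")
    case True
    then have "Suc p - (j - q) = Suc (p - (j - q))" using that by auto
    then have "(G ^^ j) (Y N p) = (br 2 ^^ Suc (p - (j - q))) (br N pivot)"
      using Y(3)[OF N(1), of "j - q" p] True that by simp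
    then show ?thesis using subsetD[OF J2_subset br2_J2[OF N(1), of "p - (j - q)"]] by simp
  next
    case False
    then show ?thesis using Y(4)[OF N(1), of p j] that pivot_cl by simp
  qed
  \<comment> \<open>For this \<open>N\<close> the term tends to \<open>0\<close> as the block grows, so it crosses \<open>\<epsilon> / 2\<close> somewhere.\<close>
  obtain p where p: "p0 \<le> p" "\<epsilon> / 2 < A N p" "A N (Suc p) \<le> \<epsilon> / 2"
  proof -
    have A_le: "A N p \<le> \<rho> ^ p * u (br N pivot)" for p
    proof -
      have "weight (q + Suc p) (Y N p) \<le> r 2 ^ (q + Suc p - Suc q)"
        by (rule weight_le[OF Y(1)[OF N(1)], where K = "q + Suc p"]) (rule Y_cl; assumption)
      then have "weight (q + Suc p) (Y N p) \<le> r 2 ^ p" by simp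
      then have "weight (q + Suc p) (Y N p) powr \<nu> \<le> (r 2 ^ p) powr \<nu>"
        using weight_pos[OF Y(1)[OF N(1)], of "q + Suc p" p] \<nu>_pos by (intro powr_mono2) auto
      then show ?thesis unfolding A_def r2_power_powr using u_br[OF N(1)] by (intro mult_right_mono) auto
    qed
    have "\<epsilon> / 2 / u (br N pivot) > 0" using \<epsilon> u_br[OF N(1)] by simp
    from real_arch_pow_inv[OF this \<rho>_bounds(2)] obtain k where k: "\<rho> ^ k < \<epsilon> / 2 / u (br N pivot)"
      by blast
    have "\<rho> ^ (p0 + k) \<le> \<rho> ^ k" using \<rho>_bounds by (intro power_decreasing) auto
    with k have "\<rho> ^ (p0 + k) < \<epsilon> / 2 / u (br N pivot)" by (rule le_less_trans[rotated])
    then have "\<rho> ^ (p0 + k) * u (br N pivot) < \<epsilon> / 2"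
      using u_br[OF N(1)] by (simp only: pos_less_divide_eq)
    with A_le[of "p0 + k"] have "A N (p0 + k) \<le> \<epsilon> / 2" by linarith
    then have "\<exists>n. A N (p0 + n) \<le> \<epsilon> / 2" ..
    moreover have "\<not> A N (p0 + 0) \<le> \<epsilon> / 2" using N(2) by simp
    ultimately obtain n where "\<not> A N (p0 + n) \<le> \<epsilon> / 2" "A N (p0 + Suc n) \<le> \<epsilon> / 2"
      using ex_least_nat_less[of "\<lambda>n. A N (p0 + n) \<le> \<epsilon> / 2"] by (metis lessI order_refl)
    then show ?thesis using that[of "p0 + n"] by simp
  qed
  define y where "y = Y N (Suc p)"
  define K where "K = q + Suc (Suc p)"
  have y: "y \<in> Lambda l r G" unfolding y_def by (rule Y(1)[OF N(1)])
  have p0p: "p0 \<le> Suc p" using p(1) by simp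
  have TK: "\<bar>T K y\<bar> = A N (Suc p)"
  proof -
    have "(G ^^ K) y = br N pivot"
      unfolding y_def K_def using Y(3)[OF N(1), of "Suc (Suc p)" "Suc p"] by simp
    then have "\<bar>T K y\<bar> = weight K y powr \<nu> * u (br N pivot)"
      using abs_T[OF y, of K] by simp
    then show ?thesis by (simp add: A_def y_def K_def)
  qed
  have TK_le: "\<bar>T K y\<bar> \<le> \<epsilon> / 2" using TK p(3) by simp
  have TK_ge: "c * (\<epsilon> / 2) \<le> \<bar>T K y\<bar>"
  proof -
    have "c * (\<epsilon> / 2) \<le> c * A N p" using p(2) c(1) by (intro mult_left_mono) auto
    also have "\<dots> \<le> A N (Suc p)" by (rule A_Suc[OF N(1) p(1)])
    finally show ?thesis using TK by simp
  qed
  \<comment> \<open>All other terms together change by at most \<open>\<eta>\<close>.\<close>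
  define e where "e i = (if i = K then 0 else T i y) - T i x" for i
  have "i0 \<le> K" using p(1) by (simp add: p0_def K_def)
  have e_le: "\<bar>e i\<bar> \<le> g i" if "q \<le> i" for i
  proof -
    have "\<bar>T i x\<bar> \<le> V * \<rho> ^ (i - Suc q)"
      using T_le[OF x(1), of q "Suc i" V i] funpow_after_pivot[OF x(2)] pivot_cl V(2) that by auto
    moreover have "\<bar>T i y\<bar> \<le> V * \<rho> ^ (i - Suc q)" if "i \<noteq> K"
      using T_le[OF y, of q K V i] Y_cl[of _ "Suc p"] V(2) \<open>q \<le> i\<close> that by (auto simp: y_def K_def)
    ultimately show ?thesis
      unfolding e_def g_def by (cases "i = K") (use V(1) \<rho>_bounds in auto)
  qed
  have e_sum: "\<bar>\<Sum>i<m. e i\<bar> \<le> \<eta>" for m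
  proof -
    have "\<bar>\<Sum>i<m. e i\<bar> \<le> (\<Sum>i<m. \<bar>e i\<bar>)" by (rule sum_abs)
    also have "\<dots> \<le> (\<Sum>i\<in>{..<i0} \<union> {i0..<m}. \<bar>e i\<bar>)" by (intro sum_mono2) auto
    also have "\<dots> = (\<Sum>i<i0. \<bar>e i\<bar>) + (\<Sum>i\<in>{i0..<m}. \<bar>e i\<bar>)"
      by (intro sum.union_disjoint) auto
    also have "(\<Sum>i<i0. \<bar>e i\<bar>) = h y"
      unfolding h_def e_def using \<open>i0 \<le> K\<close> by (intro sum.cong) auto
    also have "(\<Sum>i\<in>{i0..<m}. \<bar>e i\<bar>) \<le> sum g {i0..<m}"
      by (intro sum_mono e_le) (auto simp: i0_def)
    finally show ?thesis
      using \<delta>1(2)[OF near(2)[OF N(1) p0p]] i1[of i0 m] by (simp add: y_def i0_def)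
  qed
  have diff: "(\<Sum>i<m. T i y) - (\<Sum>i<m. T i x) = (\<Sum>i<m. e i) + (if K < m then T K y else 0)" for m
  proof -
    have "(\<Sum>i<m. T i y) - (\<Sum>i<m. T i x) = (\<Sum>i<m. e i + (if i = K then T K y else 0))"
      unfolding sum_subtractf[symmetric] by (intro sum.cong) (auto simp: e_def)
    then show ?thesis by (simp add: sum.distrib)
  qed
  have y_preimage: "y \<in> pivot_preimages"
  proof -
    have "(G ^^ Suc K) y = pivot"
      unfolding y_def by (rule Y(4)[OF N(1)]) (simp add: K_def)
    with y show ?thesis unfolding pivot_preimages_def by blast
  qed
  have "((l 2 / 2) powr \<nu> / 4) * \<epsilon> \<le> \<bar>(\<Sum>i. T i y) - (\<Sum>i. T i x)\<bar>"
  proof (rule LIMSEQ_le_const)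
    show "(\<lambda>m. \<bar>(\<Sum>i<m. T i y) - (\<Sum>i<m. T i x)\<bar>) \<longlonglongrightarrow> \<bar>(\<Sum>i. T i y) - (\<Sum>i. T i x)\<bar>"
      by (intro tendsto_intros summable_LIMSEQ summable_T y_preimage assms(1))
    have "((l 2 / 2) powr \<nu> / 4) * \<epsilon> \<le> \<bar>(\<Sum>i<m. T i y) - (\<Sum>i<m. T i x)\<bar>" if "Suc K \<le> m" for m
    proof -
      have eq: "(\<Sum>i<m. T i y) - (\<Sum>i<m. T i x) = (\<Sum>i<m. e i) + T K y"
        using diff[of m] that by simp
      have "((l 2 / 2) powr \<nu> / 4) * \<epsilon> = c * (\<epsilon> / 2) - \<eta>"
        by (simp add: \<eta>_def c_def)
      then show ?thesis unfolding eq using e_sum[of m] TK_ge by linarith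
    qed
    then show "\<exists>M. \<forall>m\<ge>M. ((l 2 / 2) powr \<nu> / 4) * \<epsilon> \<le> \<bar>(\<Sum>i<m. T i y) - (\<Sum>i<m. T i x)\<bar>" by blast
  qed
  moreover have "\<bar>(\<Sum>i<m. T i y) - (\<Sum>i<m. T i x)\<bar> \<le> \<epsilon>" for m
    unfolding diff using e_sum[of m] TK_le \<eta>(2) \<epsilon> by (auto split: if_splits)
  moreover have "\<bar>y - x\<bar> < \<delta>" unfolding y_def by (rule near(1)[OF N(1) p0p])
  ultimately show ?thesis using y_preimage by blast
qed

lemma pivot_in_preimages: "pivot \<in> pivot_preimages"
proof -
  have "pivot \<in> Lambda l r G" by (simp add: Lambda_def funpow_pivot pivot_S)
  moreover have "(G ^^ 0) pivot = pivot" by simp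
  ultimately show ?thesis unfolding pivot_preimages_def by blast
qed

sublocale perturbable_series T dom_iter pivot_preimages "(l 2 / 2) powr \<nu> / 4"
proof
  show "open (dom_iter k)" for k by (rule open_dom_iter)
  show "pivot_preimages \<subseteq> dom_iter k" for k by (auto simp: pivot_preimages_def Lambda_eq)
  show "isCont (T i) x" if "\<And>k. x \<in> dom_iter k" for x i
    using that isCont_T Lambda_eq by blast
  show "(l 2 / 2) powr \<nu> / 4 > 0" using cl_J2(1) by simp
qed (use summable_T pivot_in_preimages pivot_preimages_perturb in auto)

theorem exists_noncomputable_in_domain:
  "\<exists>x\<in>Phi_domain l r G u \<nu> s. \<not> computable_at (Phi G u \<nu> s) x"
proof -
  obtain x where "\<And>k. x \<in> dom_iter k" "summable (\<lambda>i. T i x)" "\<not> computable_at (\<lambda>x. \<Sum>i. T i x) x"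
    using exists_noncomputable_point by blast
  moreover have "(\<lambda>x. \<Sum>i. T i x) = Phi G u \<nu> s" by (simp add: Phi_def fun_eq_iff)
  ultimately show ?thesis
    unfolding Phi_domain_def using Lambda_eq by auto
qed

end

theorem theorem5p2:
  fixes l r :: "nat \<Rightarrow> real" and G u :: "real \<Rightarrow> real" and \<nu> :: real and s :: "nat \<Rightarrow> real"
  assumes interval: "\<forall>i\<ge>1. l i < r i"
    and disjoint: "disjoint_family_on (J l r) {1..}"
    and l_decreasing: "\<forall>i\<ge>1. l (Suc i) < l i"
    and S_subset: "S l r \<subseteq> {0<..<1}"
    and G_C1: "G C1_differentiable_on S l r"
    and G_range: "G ` S l r \<subseteq> {0<..<1}"
    and G1: "\<forall>i\<ge>1. G ` J l r i = {s0 l r <..< s1 l r}"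
    and G2_expanding: "\<forall>x\<in>S l r. \<bar>deriv G x\<bar> > 1"
    and G2: "\<exists>\<tau>>1. \<exists>\<sigma>>1. \<exists>\<kappa>\<ge>1. \<forall>i\<ge>1.
               inverse (tau l r G i 1) < l i * \<sigma> \<and> inverse (tau l r G i \<kappa>) < l i * inverse \<tau>"
    and G3: "strict_antimono_on (J l r 1) G"
    and G4: "\<exists>D>0. \<forall>N\<ge>1.
               (r (Suc N) / l (Suc N)) * ((r N - l (Suc N)) / delta l r G N) < D"
    and G7: "(\<lambda>i. r i / l (Suc i) - 1) \<longlonglongrightarrow> 0"
    and u_pos: "\<forall>x\<in>{s0 l r <..< s1 l r}. u x > 0"
    and u_C1: "u C1_differentiable_on {s0 l r <..< s1 l r}"
    and u_infinity: "filterlim u at_top (at_right (s0 l r))"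
    and u_deriv: "\<exists>C>0. \<forall>x\<in>{s0 l r <..< s1 l r}. deriv u x < C / (x - s0 l r)\<^sup>2"
    and \<nu>_pos: "\<nu> > 0"
    and signs: "\<forall>i\<ge>1. s i \<in> {-1, 1}"
  shows "\<exists>x\<in>Phi_domain l r G u \<nu> s. \<not> computable_at (Phi G u \<nu> s) x"
proof -
  have u_isCont: "isCont u x" if "x \<in> {s0 l r <..< s1 l r}" for x
    using C1_differentiable_imp_continuous_on[OF u_C1] that
    by (simp add: continuous_on_eq_continuous_at)
  interpret weighted_branch_map l r G u \<nu> s
  proof
    show "G ` J l r i = {s0 l r <..< s1 l r}" if "1 \<le> i" for i
      using G1 that by blast
  qed (use assms u_isCont in auto)
  show ?thesis by (rule exists_noncomputable_in_domain)
qed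

end
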